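(* Consider the random profile matching problem RPMP-$k$ (defined in the context) with $n$ men, $n$ women and $k=k(n)\ge 1$, where $d$ is an arbitrary metric on $Q_k$. Fix $\epsilon>0$. Then, with high probability (i.e., with probability tending to $1$ as $n\to\infty$): (i) if $k<(1-\epsilon)\log n$, the fraction of participants with multiple stable partners tends to zero as $n\to\infty$ (tie-breaking lists being used to form the preference lists); and (ii) if $k=\lfloor\log n\rfloor$, there are $O(n)$ participants with multiple stable partners and there are exponentially many (in $n$) stable matchings.
   Context: RPMP-$k$: there is a set $\mathcal{M}$ of $n$ men and a set $\mathcal{W}$ of $n$ women. Each participant $x$ has a profile $\mathbf{a}(x)\in Q_k=\{0,1\}^k$; the profiles of all participants are independent and uniformly distributed on $Q_k$. Let $d$ be a metric on $Q_k$ and write $d(x,y)=d(\mathbf{a}(x),\mathbf{a}(y))$. Each participant $x$ has a tie-breaking list $T_x$, a uniformly random ordering of the members of the opposite sex, all tie-breaking lists being independent of each other and of the profiles. The strict preference list of $x$ ranks the opposite sex in increasing order of $d(x,\cdot)$, breaking ties by $T_x$. A matching pairs men and women (each person matched to at most one partner); a pair $(m,w)$ not matched together blocks it if each prefers the other to his/her assigned partner; a matching is stable if no blocking pair exists. $y$ is a stable partner of $x$ if $x$ and $y$ are matched in some stable matching. Here $\log$ denotes the base-$2$ logarithm. *)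

theory Defs
  imports "HOL-Probability.Probability"
begin

definition Qk :: "nat \<Rightarrow> bool list set" where
  "Qk k = {xs. length xs = k}"

definition metric_on :: "'a set \<Rightarrow> ('a \<Rightarrow> 'a \<Rightarrow> real) \<Rightarrow> bool" where
  "metric_on S d \<longleftrightarrow>
     (\<forall>x\<in>S. \<forall>y\<in>S. d x y \<ge> 0 \<and> (d x y = 0 \<longleftrightarrow> x = y) \<and> d x y = d y x) \<and>
     (\<forall>x\<in>S. \<forall>y\<in>S. \<forall>z\<in>S. d x z \<le> d x y + d y z)"

text \<open>Men and women are both indexed by {..<n}. A tie-breaking list of a participant
  is encoded as a rank function: a bijection from {..<n} (members of the opposite sex)
  to {..<n} (positions in the list).\<close>
definition rankings :: "nat \<Rightarrow> (nat \<Rightarrow> nat) set" where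
  "rankings n = {f \<in> {..<n} \<rightarrow>\<^sub>E {..<n}. bij_betw f {..<n} {..<n}}"

text \<open>A configuration: (profiles of men, profiles of women,
  tie-breaking ranks of men, tie-breaking ranks of women).\<close>
type_synonym config = "(nat \<Rightarrow> bool list) \<times> (nat \<Rightarrow> bool list) \<times> (nat \<Rightarrow> nat \<Rightarrow> nat) \<times> (nat \<Rightarrow> nat \<Rightarrow> nat)"

definition config_space :: "nat \<Rightarrow> nat \<Rightarrow> config set" where
  "config_space n k =
     ({..<n} \<rightarrow>\<^sub>E Qk k) \<times> ({..<n} \<rightarrow>\<^sub>E Qk k) \<times>
     ({..<n} \<rightarrow>\<^sub>E rankings n) \<times> ({..<n} \<rightarrow>\<^sub>E rankings n)"

definition rpmp :: "nat \<Rightarrow> nat \<Rightarrow> config pmf" where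
  "rpmp n k = pmf_of_set (config_space n k)"

definition man_prefers :: "(bool list \<Rightarrow> bool list \<Rightarrow> real) \<Rightarrow> config \<Rightarrow> nat \<Rightarrow> nat \<Rightarrow> nat \<Rightarrow> bool" where
  "man_prefers d c m w1 w2 = (case c of (am, aw, Tm, Tw) \<Rightarrow>
      d (am m) (aw w1) < d (am m) (aw w2) \<or>
      (d (am m) (aw w1) = d (am m) (aw w2) \<and> Tm m w1 < Tm m w2))"

definition woman_prefers :: "(bool list \<Rightarrow> bool list \<Rightarrow> real) \<Rightarrow> config \<Rightarrow> nat \<Rightarrow> nat \<Rightarrow> nat \<Rightarrow> bool" where
  "woman_prefers d c w m1 m2 = (case c of (am, aw, Tm, Tw) \<Rightarrow>
      d (aw w) (am m1) < d (aw w) (am m2) \<or>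
      (d (aw w) (am m1) = d (aw w) (am m2) \<and> Tw w m1 < Tw w m2))"

definition is_matching :: "nat \<Rightarrow> (nat \<times> nat) set \<Rightarrow> bool" where
  "is_matching n M \<longleftrightarrow> M \<subseteq> {..<n} \<times> {..<n} \<and>
     (\<forall>m w w'. (m, w) \<in> M \<longrightarrow> (m, w') \<in> M \<longrightarrow> w = w') \<and>
     (\<forall>m m' w. (m, w) \<in> M \<longrightarrow> (m', w) \<in> M \<longrightarrow> m = m')"

text \<open>(m,w) blocks M: not matched together, and each prefers the other to the assigned
  partner (an unmatched participant prefers anyone to being unmatched).\<close>
definition blocking :: "nat \<Rightarrow> (bool list \<Rightarrow> bool list \<Rightarrow> real) \<Rightarrow> config \<Rightarrow> (nat \<times> nat) set \<Rightarrow> nat \<Rightarrow> nat \<Rightarrow> bool" where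
  "blocking n d c M m w \<longleftrightarrow> m < n \<and> w < n \<and> (m, w) \<notin> M \<and>
     (\<forall>w'. (m, w') \<in> M \<longrightarrow> man_prefers d c m w w') \<and>
     (\<forall>m'. (m', w) \<in> M \<longrightarrow> woman_prefers d c w m m')"

definition stable :: "nat \<Rightarrow> (bool list \<Rightarrow> bool list \<Rightarrow> real) \<Rightarrow> config \<Rightarrow> (nat \<times> nat) set \<Rightarrow> bool" where
  "stable n d c M \<longleftrightarrow> is_matching n M \<and> \<not> (\<exists>m w. blocking n d c M m w)"

definition stable_matchings :: "nat \<Rightarrow> (bool list \<Rightarrow> bool list \<Rightarrow> real) \<Rightarrow> config \<Rightarrow> (nat \<times> nat) set set" where
  "stable_matchings n d c = {M. stable n d c M}"

definition stable_partners_man :: "nat \<Rightarrow> (bool list \<Rightarrow> bool list \<Rightarrow> real) \<Rightarrow> config \<Rightarrow> nat \<Rightarrow> nat set" where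
  "stable_partners_man n d c m = {w. \<exists>M. stable n d c M \<and> (m, w) \<in> M}"

definition stable_partners_woman :: "nat \<Rightarrow> (bool list \<Rightarrow> bool list \<Rightarrow> real) \<Rightarrow> config \<Rightarrow> nat \<Rightarrow> nat set" where
  "stable_partners_woman n d c w = {m. \<exists>M. stable n d c M \<and> (m, w) \<in> M}"

definition num_multi :: "nat \<Rightarrow> (bool list \<Rightarrow> bool list \<Rightarrow> real) \<Rightarrow> config \<Rightarrow> nat" where
  "num_multi n d c =
     card {m \<in> {..<n}. card (stable_partners_man n d c m) \<ge> 2} +
     card {w \<in> {..<n}. card (stable_partners_woman n d c w) \<ge> 2}"

end

theory Submission
  imports Defs "HOL-Combinatorics.Transposition"
begin

text \<open>
  Profiles at distance zero coincide, so everyone prefers members of the own profile class to all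
  others, ordered by tie breaks. If a class has \<open>A\<close> men and \<open>B \<ge> A\<close> women, every stable matching
  matches all its men inside the class, and there it is stable for uniformly random lists.
  Let a woman \<open>y\<close> who is matched in the man-optimal matching reject all who proposed to her. The resulting
  chain of proposals ends when it reaches \<open>y\<close> again or one of the \<open>B - A\<close> women without proposals. By
  symmetry of the unread parts of the men's lists, the first of these \<open>B - A + 1\<close> disjoint cases is at most as
  likely as each of the others, and only in that case \<open>y\<close> has another stable partner. As \<open>A\<close> and \<open>B\<close> are independent
  binomial variables with mean \<open>n / 2 ^ k\<close>, their difference is typically large but of smaller order than the mean as
  soon as that mean tends to infinity, which gives (i).

  For (ii), a class consisting of two men and two women with crossed tie breaks has two stable matchings, which
  can be exchanged independently in every stable matching. The expected number of such classes is
  linear in \<open>n\<close>, and changing one profile or one tie-breaking list changes it by at most two,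
  so its variance is linear as well (Efron-Stein) and Chebyshev's inequality applies.
\<close>

section \<open>Proposals in a market with strict ranks\<close>

text \<open>Part (i) balances two opposite effects. With \<open>D = B - A\<close>, the
  \<open>D\<close> surplus members of a class may have several partners outside it, while every
  other member of the larger side gets a second partner with probability at most
  \<open>1 / (D + 1)\<close>. So \<open>D\<close> must be neither comparable to the mean nor
  bounded. The variance controls large \<open>D\<close>. For small \<open>D\<close> a tail bound
  says nothing; what is needed is anti-concentration, hence the uniform bound on single binomial
  weights.

  The symmetry is not taken from revealing random lists step by step but from an explicit injection
  on lists: \<open>y\<close> and a woman without proposals are exchanged exactly in the lists of
  those who have not reached \<open>y\<close>. This compares the ordinary process and the chain
  under two different systems of lists, which is manageable because proposals form an order-free
  least fixed point. Only the proposers' lists vary; the other side's lists stay fixed.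

  Which sex is the larger one differs from class to class, so the markets below have neutral sides
  \<open>X\<close> (smaller, proposing) and \<open>Y\<close>.\<close>

text \<open>The proposals made in deferred acceptance, in any order, form a least fixed point. The pairs in
  \<open>F\<close> are rejected from the start, and the members of \<open>Z\<close> make no other rejections, so they may hold several
  proposers.\<close>

inductive proposes :: "'a set \<Rightarrow> 'b set \<Rightarrow> ('a \<Rightarrow> 'b \<Rightarrow> nat) \<Rightarrow> ('b \<Rightarrow> 'a \<Rightarrow> nat) \<Rightarrow> 'b set \<Rightarrow> ('a \<times> 'b) set \<Rightarrow> 'a \<Rightarrow> 'b \<Rightarrow> bool"
  for X Y f g Z F where
  proposesI: "x \<in> X \<Longrightarrow> y \<in> Y \<Longrightarrow>
    (\<And>y'. y' \<in> Y \<Longrightarrow> f x y' < f x y \<Longrightarrow>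
       (x, y') \<in> F \<or> (y' \<notin> Z \<and> (\<exists>x'. proposes X Y f g Z F x' y' \<and> g y' x' < g y' x))) \<Longrightarrow>
    proposes X Y f g Z F x y"

definition rejects :: "'a set \<Rightarrow> 'b set \<Rightarrow> ('a \<Rightarrow> 'b \<Rightarrow> nat) \<Rightarrow> ('b \<Rightarrow> 'a \<Rightarrow> nat) \<Rightarrow> 'b set \<Rightarrow> ('a \<times> 'b) set \<Rightarrow> 'a \<Rightarrow> 'b \<Rightarrow> bool" where
  "rejects X Y f g Z F x y \<longleftrightarrow> (x, y) \<in> F \<or> (y \<notin> Z \<and> (\<exists>x'. proposes X Y f g Z F x' y \<and> g y x' < g y x))"

lemma proposes_in: assumes "proposes X Y f g Z F x y" shows "x \<in> X" "y \<in> Y"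
  using assms by (auto elim: proposes.cases)

lemma proposes_iff:
  "proposes X Y f g Z F x y \<longleftrightarrow> x \<in> X \<and> y \<in> Y \<and> (\<forall>y'\<in>Y. f x y' < f x y \<longrightarrow> rejects X Y f g Z F x y')"
  unfolding rejects_def by (subst proposes.simps) blast

lemma proposes_better:
  assumes "proposes X Y f g Z F x y" "y' \<in> Y" "f x y' < f x y"
  shows "proposes X Y f g Z F x y'" "rejects X Y f g Z F x y'"
  using assms unfolding proposes_iff[of _ _ _ _ _ _ x] by auto

text \<open>\<open>rejects\<close> also speaks of pairs without a proposal, so the best
  \<open>y\<close> that does not reject \<open>x\<close> is where the proposals of \<open>x\<close>
  come to rest: everything ranked above it rejects \<open>x\<close>.\<close>

lemma proposes_unrejected_ex:
  assumes "finite Y" "x \<in> X" "y \<in> Y" "\<not> rejects X Y f g Z F x y"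
  shows "\<exists>y. proposes X Y f g Z F x y \<and> \<not> rejects X Y f g Z F x y"
proof -
  let ?S = "{y \<in> Y. \<not> rejects X Y f g Z F x y}"
  have "finite ?S" "?S \<noteq> {}" using assms by auto
  then obtain y1 where y1: "y1 \<in> ?S" "\<And>y. y \<in> ?S \<Longrightarrow> f x y1 \<le> f x y"
    using arg_min_if_finite(1)[of ?S "f x"] arg_min_least[of ?S _ "f x"] by blast
  have "proposes X Y f g Z F x y1"
    unfolding proposes_iff[of _ _ _ _ _ _ x] using y1 assms by force
  then show ?thesis using y1 by auto
qed

text \<open>A rejection outside \<open>F\<close> needs a better proposer, so the best proposer of
  \<open>y\<close> is safe.\<close>

lemma proposes_holder_ex:
  assumes "finite X" "proposes X Y f g Z F x y" "\<And>x. (x, y) \<notin> F"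
  shows "\<exists>x. proposes X Y f g Z F x y \<and> \<not> rejects X Y f g Z F x y"
proof -
  let ?S = "{x. proposes X Y f g Z F x y}"
  have "finite ?S" using assms(1) by (rule finite_subset[rotated]) (auto dest: proposes_in)
  moreover have "?S \<noteq> {}" using assms by auto
  ultimately obtain x1 where x1: "x1 \<in> ?S" "\<And>x. x \<in> ?S \<Longrightarrow> g y x1 \<le> g y x"
    using arg_min_if_finite(1)[of ?S "g y"] arg_min_least[of ?S _ "g y"] by blast
  then have "\<not> rejects X Y f g Z F x1 y"
    using assms(3) unfolding rejects_def by force
  then show ?thesis using x1 by auto
qed

text \<open>Ordinary proposals survive in the chain: whoever moved past \<open>y0\<close> in the
  ordinary process had proposed to \<open>y0\<close> and is therefore rejected there through
  \<open>F\<close>.\<close>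

lemma proposes_mono:
  assumes "proposes X Y f g {} {} x y" "\<And>x. proposes X Y f g {} {} x y0 \<Longrightarrow> (x, y0) \<in> F"
  shows "proposes X Y f g {y0} F x y"
  using assms(1)
proof (induction rule: proposes.induct)
  case (proposesI x y)
  have *: "proposes X Y f g {} {} x y"
    using proposesI by (intro proposes.proposesI) auto
  show ?case
  proof (rule proposes.proposesI)
    fix y' assume y': "y' \<in> Y" "f x y' < f x y"
    show "(x, y') \<in> F \<or> (y' \<notin> {y0} \<and> (\<exists>x'. proposes X Y f g {y0} F x' y' \<and> g y' x' < g y' x))"
      using proposesI(3)[OF y'] assms(2) proposes_better(1)[OF * y'] by auto
  qed (use proposesI in auto)
qed

locale market =
  fixes X :: "'a set" and Y :: "'b set" and f :: "'a \<Rightarrow> 'b \<Rightarrow> nat" and g :: "'b \<Rightarrow> 'a \<Rightarrow> nat"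
  assumes finX: "finite X" and finY: "finite Y"
    and injf: "x \<in> X \<Longrightarrow> inj_on (f x) Y" and injg: "y \<in> Y \<Longrightarrow> inj_on (g y) X"
begin

abbreviation "pr \<equiv> proposes X Y f g"
abbreviation "rj \<equiv> rejects X Y f g"

abbreviation "P \<equiv> proposes X Y f g {} {}"
abbreviation "R \<equiv> rejects X Y f g {} {}"

lemma holder_unique:
  assumes "pr Z F x y" "\<not> rj Z F x y" "pr Z F x y'" "\<not> rj Z F x y'"
  shows "y = y'"
  using assms proposes_better[of X Y f g Z F x] proposes_in[of X Y f g Z F x] injf[of x]
  by (metis inj_on_def linorder_neqE_nat)

lemma held_unique:
  assumes "pr Z F x y" "\<not> rj Z F x y" "pr Z F x' y" "\<not> rj Z F x' y" "y \<notin> Z"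
  shows "x = x'"
  using assms proposes_in[of X Y f g Z F] injg[of y] unfolding rejects_def
  by (metis inj_on_def linorder_neqE_nat)

lemma holder_ex: "P x y \<Longrightarrow> \<exists>x. P x y \<and> \<not> R x y"
  by (rule proposes_holder_ex[OF finX]) auto

section \<open>The proposer-optimal outcome and its relation to all other stable matchings\<close>

definition reached :: "'b set" where "reached = {y. \<exists>x. P x y}"

lemma reached_sub: "reached \<subseteq> Y" unfolding reached_def by (auto dest: proposes_in)

text \<open>If all of \<open>Y\<close> rejected \<open>x\<close>, every \<open>y\<close> would hold
  a proposer of her own different from \<open>x\<close>, and \<open>X\<close> would have more than
  \<open>card Y\<close> members.\<close>

lemma hold_ex:
  assumes "card X \<le> card Y" "x \<in> X"
  shows "\<exists>y. P x y \<and> \<not> R x y"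
proof (rule ccontr)
  assume n: "\<not> ?thesis"
  have all: "R x y" if "y \<in> Y" for y
    using proposes_unrejected_ex[of Y x X y f g "{}" "{}"] n finY assms that by auto
  have "\<exists>x'. P x' y \<and> \<not> R x' y" if "y \<in> Y" for y
    using all[OF that] proposes_holder_ex[of X Y f g "{}" "{}" _ y] finX unfolding rejects_def[of _ _ _ _ _ _ x] by auto
  then obtain h where h: "\<And>y. y \<in> Y \<Longrightarrow> P (h y) y \<and> \<not> R (h y) y" by metis
  have "inj_on h Y" by (rule inj_onI) (metis h holder_unique)
  moreover have "h ` Y \<subseteq> X - {x}" using h all by (auto dest: proposes_in)
  ultimately have "card Y \<le> card (X - {x})" using finX by (metis card_inj_on_le finite_Diff)
  then show False using assms finX by (metis card_Diff1_less leD order.strict_trans2)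
qed

definition hold :: "'a \<Rightarrow> 'b" where "hold x = (SOME y. P x y \<and> \<not> R x y)"

lemma hold:
  assumes "card X \<le> card Y" "x \<in> X"
  shows "P x (hold x)" "\<not> R x (hold x)"
  using someI_ex[OF hold_ex[OF assms]] unfolding hold_def by auto

lemma hold_bij: assumes "card X \<le> card Y" shows "bij_betw hold X reached"
proof (rule bij_betwI')
  show "\<And>x y. x \<in> X \<Longrightarrow> y \<in> X \<Longrightarrow> (hold x = hold y) = (x = y)"
    using hold[OF assms] held_unique[of "{}" "{}"] by (metis empty_iff)
  show "\<And>x. x \<in> X \<Longrightarrow> hold x \<in> reached" using hold[OF assms] unfolding reached_def by auto
  fix y assume "y \<in> reached"
  then obtain x where "P x y" unfolding reached_def by auto
  then obtain x where x: "P x y" "\<not> R x y" using holder_ex by blast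
  then have "x \<in> X" by (auto dest: proposes_in)
  with x show "\<exists>x\<in>X. y = hold x" using hold[OF assms] holder_unique by blast
qed

lemma card_reached: assumes "card X \<le> card Y" shows "card reached = card X"
  using hold_bij[OF assms] by (simp add: bij_betw_same_card)

text \<open>All of \<open>X\<close> is matched by definition, since \<open>X\<close> is going to be
  the smaller side. The last clause also forbids that anyone prefers an unmatched \<open>y\<close>
  to the own partner.\<close>

definition lstable :: "('a \<times> 'b) set \<Rightarrow> bool" where
  "lstable L \<longleftrightarrow> L \<subseteq> X \<times> Y \<and>
    (\<forall>x\<in>X. \<exists>!y. (x, y) \<in> L) \<and>
    (\<forall>x x' y. (x, y) \<in> L \<longrightarrow> (x', y) \<in> L \<longrightarrow> x = x') \<and>
    (\<forall>x y y'. (x, y') \<in> L \<longrightarrow> y \<in> Y \<longrightarrow> f x y < f x y' \<longrightarrow> (\<exists>x'. (x', y) \<in> L \<and> g y x' < g y x))"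

lemma lstable_in: "lstable L \<Longrightarrow> (x, y) \<in> L \<Longrightarrow> x \<in> X" "lstable L \<Longrightarrow> (x, y) \<in> L \<Longrightarrow> y \<in> Y"
  unfolding lstable_def by auto

lemma lstable_ex: "lstable L \<Longrightarrow> x \<in> X \<Longrightarrow> \<exists>y. (x, y) \<in> L"
  unfolding lstable_def by blast

lemma lstable_fun: "lstable L \<Longrightarrow> (x, y) \<in> L \<Longrightarrow> (x, y') \<in> L \<Longrightarrow> y = y'"
  unfolding lstable_def by blast

lemma lstable_inj: "lstable L \<Longrightarrow> (x, y) \<in> L \<Longrightarrow> (x', y) \<in> L \<Longrightarrow> x = x'"
  unfolding lstable_def by simp

lemma lstable_block: "lstable L \<Longrightarrow> (x, y') \<in> L \<Longrightarrow> y \<in> Y \<Longrightarrow> f x y < f x y' \<Longrightarrow> \<exists>x'. (x', y) \<in> L \<and> g y x' < g y x"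
  unfolding lstable_def by simp

lemma lstable_hold:
  assumes "card X \<le> card Y" shows "lstable {(x, hold x) |x. x \<in> X}"
  unfolding lstable_def
proof (intro conjI allI ballI impI)
  show "{(x, hold x) |x. x \<in> X} \<subseteq> X \<times> Y" using hold[OF assms] by (auto dest: proposes_in)
  show "x = x'" if "(x, y) \<in> {(x, hold x) |x. x \<in> X}" "(x', y) \<in> {(x, hold x) |x. x \<in> X}" for x x' y
    using that hold_bij[OF assms] by (auto simp: bij_betw_def inj_on_def)
  fix x y y' assume a: "(x, y') \<in> {(x, hold x) |x. x \<in> X}" "y \<in> Y" "f x y < f x y'"
  then have "R x y" using proposes_better(2)[of X Y f g "{}" "{}" x y' y] hold[OF assms, of x] by auto
  then obtain x' where x': "P x' y" "g y x' < g y x" unfolding rejects_def by auto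
  then obtain z where z: "P z y" "\<not> R z y" using holder_ex by blast
  then have "g y z \<le> g y x'" using x' unfolding rejects_def by force
  moreover have "y = hold z" using z hold[OF assms] holder_unique proposes_in by metis
  ultimately show "\<exists>x'. (x', y) \<in> {(x, hold x) |x. x \<in> X} \<and> g y x' < g y x"
    using z x' by (auto dest: proposes_in intro!: exI[of _ z])
qed auto

text \<open>Nobody moves past a stable partner \<open>y'\<close>: she would have rejected
  \<open>x\<close> for a proposer \<open>x'\<close> who, by induction, has not moved past the own
  partner, so \<open>x'\<close> and \<open>y'\<close> would block \<open>L\<close>. \<open>Z\<close>
  and \<open>F\<close> are general so that the argument also covers the rejection chain.\<close>

lemma lstable_proposes:
  assumes L: "lstable L" and F: "F \<inter> L = {}" and p: "pr Z F x y" and y': "(x, y') \<in> L"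
  shows "f x y \<le> f x y'"
  using p y'
proof (induction arbitrary: y' rule: proposes.induct)
  case (proposesI x y)
  show ?case
  proof (rule ccontr)
    assume "\<not> ?thesis"
    then have l: "f x y' < f x y" by simp
    have y'Y: "y' \<in> Y" using proposesI.prems L unfolding lstable_def by auto
    have "(x, y') \<notin> F" using F proposesI.prems by auto
    then obtain x' where x': "pr Z F x' y'" "\<And>y''. (x', y'') \<in> L \<Longrightarrow> f x' y' \<le> f x' y''" "g y' x' < g y' x"
      using proposesI(3)[OF y'Y l] by auto
    have x'X: "x' \<in> X" using x'(1) by (auto dest: proposes_in)
    then obtain y'' where y'': "(x', y'') \<in> L" using lstable_ex[OF L] by blast
    have "y'' \<in> Y" using lstable_in[OF L y''] by simp
    have "y'' \<noteq> y'" using lstable_inj[OF L proposesI.prems] y'' x'(3) by blast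
    then have "f x' y'' \<noteq> f x' y'" using injf[OF x'X] \<open>y'' \<in> Y\<close> y'Y by (auto simp: inj_on_def)
    then have "f x' y' < f x' y''" using x'(2)[OF y''] by simp
    then obtain x3 where "(x3, y') \<in> L" "g y' x3 < g y' x'" using lstable_block[OF L y'' y'Y] by blast
    then show False using x'(3) lstable_inj[OF L proposesI.prems, of x3] by simp
  qed
qed

lemma lstable_not_rej:
  assumes L: "lstable L" and F: "F \<inter> L = {}" and xy: "(x, y) \<in> L"
  shows "\<not> rj Z F x y"
proof
  assume "rj Z F x y"
  then obtain x' where x': "pr Z F x' y" "g y x' < g y x" using F xy unfolding rejects_def by auto
  have x'X: "x' \<in> X" and yY: "y \<in> Y" using x'(1) by (auto dest: proposes_in)
  then obtain y'' where y'': "(x', y'') \<in> L" using lstable_ex[OF L] by blast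
  have "y'' \<in> Y" using lstable_in[OF L y''] by simp
  have "y'' \<noteq> y" using lstable_inj[OF L xy] y'' x'(2) by blast
  then have "f x' y'' \<noteq> f x' y" using injf[OF x'X] \<open>y'' \<in> Y\<close> yY by (auto simp: inj_on_def)
  then have "f x' y < f x' y''" using lstable_proposes[OF L F x'(1) y''] by simp
  then obtain x3 where "(x3, y) \<in> L" "g y x3 < g y x'" using lstable_block[OF L y'' yY] by blast
  then show False using x'(2) lstable_inj[OF L xy, of x3] by simp
qed

lemma reached_matched:
  assumes L: "lstable L" and y: "y \<in> reached" shows "\<exists>x. (x, y) \<in> L"
proof -
  obtain x where x: "P x y" using y unfolding reached_def by auto
  then have "x \<in> X" "y \<in> Y" by (auto dest: proposes_in)
  then obtain y' where y': "(x, y') \<in> L" using lstable_ex[OF L] by blast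
  have le: "f x y \<le> f x y'" using lstable_proposes[OF L _ x y'] by simp
  show ?thesis
  proof (cases "y = y'")
    case False
    have "y' \<in> Y" using lstable_in[OF L y'] by simp
    then have "f x y < f x y'" using le False injf[OF \<open>x \<in> X\<close>] \<open>y \<in> Y\<close>
      by (metis inj_on_def le_neq_implies_less)
    then show ?thesis using lstable_block[OF L y' \<open>y \<in> Y\<close>] by blast
  qed (use y' in auto)
qed

text \<open>With \<open>reached_matched\<close> this is the rural hospitals theorem: all stable
  matchings cover the same part of \<open>Y\<close>. They cover \<open>reached\<close>, which
  already has \<open>card X\<close> members, so there is room for nobody else.\<close>

lemma lstable_imp_reached:
  assumes L: "lstable L" and le: "card X \<le> card Y" and xy: "(x, y) \<in> L" shows "y \<in> reached"
proof -
  have "reached \<subseteq> snd ` L" using reached_matched[OF L] by force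
  moreover have fL: "finite L" by (rule finite_subset[of L "X \<times> Y"]) (use lstable_in[OF L] finX finY in auto)
  moreover have "card (snd ` L) \<le> card reached"
  proof -
    have "card (snd ` L) \<le> card L" using fL card_image_le by auto
    also have "card L = card (fst ` L)"
      by (rule card_image[symmetric]) (use lstable_fun[OF L] in \<open>auto simp: inj_on_def\<close>)
    also have "\<dots> \<le> card X" using finX lstable_in[OF L] by (intro card_mono) auto
    finally show ?thesis using card_reached[OF le] by simp
  qed
  ultimately have "reached = snd ` L" by (intro card_seteq) auto
  then show ?thesis using xy by force
qed

text \<open>The rejection chain: \<open>y0\<close> rejects everyone who proposed to her in the ordinary process and
  accepts every new proposer.\<close>

definition pr2 :: "'b \<Rightarrow> 'a \<Rightarrow> 'b \<Rightarrow> bool" where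
  "pr2 y0 = pr {y0} ({x. P x y0} \<times> {y0})"

text \<open>The chain started by \<open>y0\<close> brings a new proposer to \<open>z\<close>. For
  \<open>z = y0\<close> it has returned, for \<open>z\<close> outside \<open>reached\<close> it has
  ended there.\<close>

definition gains :: "'b \<Rightarrow> 'b \<Rightarrow> bool" where
  "gains y0 z \<longleftrightarrow> (\<exists>x. pr2 y0 x z \<and> \<not> P x z)"

text \<open>The partner in \<open>L\<close> never rejects, so in the chain everyone in
  \<open>X\<close> comes to rest somewhere. If \<open>y0\<close> got nobody new, these places would
  be distinct and different from \<open>y0\<close>; one of them lies outside \<open>reached\<close>,
  because \<open>reached - {y0}\<close> has only \<open>card X - 1\<close> members. Its proposer
  prefers it to the partner in \<open>L\<close>, so it must be matched in \<open>L\<close>, against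
  the rural hospitals theorem.\<close>

lemma gains_if_other_partner:
  assumes L: "lstable L" and le: "card X \<le> card Y" and xy: "(x1, y0) \<in> L" and nP: "\<not> P x1 y0"
  shows "gains y0 y0"
proof (rule ccontr)
  assume no: "\<not> gains y0 y0"
  let ?F = "{x. P x y0} \<times> {y0}"
  have F: "?F \<inter> L = {}" using nP lstable_inj[OF L xy] by blast
  have y0V: "y0 \<in> reached" using lstable_imp_reached[OF L le xy] .
  have "\<exists>y. pr {y0} ?F x y \<and> \<not> rj {y0} ?F x y" if x: "x \<in> X" for x
  proof -
    obtain y where y: "(x, y) \<in> L" using lstable_ex[OF L x] by blast
    then have "y \<in> Y" using lstable_in[OF L] by blast
    with proposes_unrejected_ex[OF finY x this lstable_not_rej[OF L F y]] show ?thesis by blast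
  qed
  then obtain h where h: "\<And>x. x \<in> X \<Longrightarrow> pr {y0} ?F x (h x) \<and> \<not> rj {y0} ?F x (h x)" by metis
  have hy0: "h x \<noteq> y0" if "x \<in> X" for x
  proof
    assume "h x = y0"
    then have "pr2 y0 x y0" using h[OF that] unfolding pr2_def by auto
    then have "P x y0" using no unfolding gains_def by auto
    then have "rj {y0} ?F x y0" unfolding rejects_def by auto
    then show False using h[OF that] \<open>h x = y0\<close> by auto
  qed
  have inj: "inj_on h X"
    by (rule inj_onI) (metis h held_unique hy0 singletonD)
  have "\<not> h ` X \<subseteq> reached - {y0}"
  proof
    assume "h ` X \<subseteq> reached - {y0}"
    then have "card X \<le> card (reached - {y0})" using card_inj_on_le[OF inj] reached_sub finY finite_subset by blast
    also have "\<dots> < card reached" using y0V reached_sub finY by (meson card_Diff1_less finite_subset)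
    finally show False using card_reached[OF le] by simp
  qed
  then obtain x where x: "x \<in> X" "h x \<notin> reached" using hy0 by auto
  obtain y where y: "(x, y) \<in> L" using lstable_ex[OF L x(1)] by blast
  have hY: "h x \<in> Y" using h[OF x(1)] by (auto dest: proposes_in)
  have yV: "y \<in> reached" using lstable_imp_reached[OF L le y] .
  have "f x (h x) \<le> f x y" using lstable_proposes[OF L F _ y] h[OF x(1)] by blast
  moreover have "f x (h x) \<noteq> f x y" using injf[OF x(1)] hY yV reached_sub x(2) by (auto simp: inj_on_def)
  ultimately have "f x (h x) < f x y" by simp
  then obtain x' where "(x', h x) \<in> L" using lstable_block[OF L y hY] by blast
  then show False using lstable_imp_reached[OF L le] x(2) by blast
qed

text \<open>In the chain each member of \<open>reached - {y0}\<close> still holds a proposer. This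
  uses up \<open>card X - 1\<close> of them, and the one left over can rest at only one
  place.\<close>

lemma gains_unique:
  assumes le: "card X \<le> card Y" and y0: "y0 \<in> reached"
    and z: "z \<in> insert y0 (Y - reached)" "z' \<in> insert y0 (Y - reached)" and O: "gains y0 z" "gains y0 z'"
  shows "z = z'"
proof -
  let ?F = "{x. P x y0} \<times> {y0}"
  have ex: "\<exists>x. pr {y0} ?F x z \<and> \<not> rj {y0} ?F x z" if "gains y0 z" "z \<in> insert y0 (Y - reached)" for z
  proof (cases "z = y0")
    case True
    then show ?thesis using that unfolding gains_def pr2_def rejects_def by auto
  next
    case False
    then show ?thesis using that proposes_holder_ex[OF finX, of Y f g "{y0}" ?F _ z] unfolding gains_def pr2_def by auto
  qed
  obtain x where x: "pr {y0} ?F x z" "\<not> rj {y0} ?F x z" using ex O z by blast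
  obtain x' where x': "pr {y0} ?F x' z'" "\<not> rj {y0} ?F x' z'" using ex O z by blast
  have "\<exists>x. pr {y0} ?F x y \<and> \<not> rj {y0} ?F x y" if y: "y \<in> reached - {y0}" for y
  proof -
    obtain x where "P x y" using y unfolding reached_def by auto
    then have "pr {y0} ?F x y" by (rule proposes_mono) auto
    then show ?thesis using proposes_holder_ex[OF finX, of Y f g "{y0}" ?F _ y] y by auto
  qed
  then obtain h where h: "\<And>y. y \<in> reached - {y0} \<Longrightarrow> pr {y0} ?F (h y) y \<and> \<not> rj {y0} ?F (h y) y" by metis
  have inj: "inj_on h (reached - {y0})" by (rule inj_onI) (metis h holder_unique)
  have nx: "h y \<noteq> x" "h y \<noteq> x'" if "y \<in> reached - {y0}" for y
    using h[OF that] x x' holder_unique[of "{y0}" ?F] z that by blast+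
  have "h ` (reached - {y0}) \<subseteq> X - {x, x'}" using nx h by (auto dest: proposes_in)
  then have "card (reached - {y0}) \<le> card (X - {x, x'})" using card_inj_on_le[OF inj] finX by blast
  moreover have "card (reached - {y0}) = card X - 1" using y0 reached_sub finY card_reached[OF le]
    by (metis card_Diff_singleton)
  moreover have "x \<in> X" "x' \<in> X" using x x' by (auto dest: proposes_in)
  moreover have "card (X - {x, x'}) = card X - card {x, x'}" using \<open>x \<in> X\<close> \<open>x' \<in> X\<close>
    by (intro card_Diff_subset) auto
  moreover have "card {x, x'} \<le> card X" using \<open>x \<in> X\<close> \<open>x' \<in> X\<close> finX by (intro card_mono) auto
  ultimately have "x = x'" by (cases "x = x'") auto
  then show ?thesis using x x' holder_unique by blast
qed

end

section \<open>Counting those with several stable partners, and the exchange of list tails\<close>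

context market
begin

definition improvable :: "'b set" where "improvable = {y \<in> reached. gains y y}"

lemma improvable_fin: "finite improvable"
  using reached_sub finY unfolding improvable_def by (auto intro: finite_subset)

text \<open>A stable partner \<open>x\<close> of \<open>y\<close> is never rejected, so if
  \<open>x\<close> had proposed to \<open>y\<close>, she would hold both \<open>x\<close> and
  \<open>x0\<close>.\<close>

lemma in_improvable:
  assumes le: "card X \<le> card Y" and h: "P x0 y" "\<not> R x0 y" and L: "lstable L" and x: "(x, y) \<in> L" "x \<noteq> x0"
  shows "y \<in> improvable"
proof -
  have "\<not> R x y" using lstable_not_rej[OF L _ x(1)] by auto
  then have "\<not> P x y" using held_unique[of "{}" "{}"] h x(2) by blast
  then have "gains y y" using gains_if_other_partner[OF L le x(1)] by simp
  then show ?thesis using lstable_imp_reached[OF L le x(1)] unfolding improvable_def by simp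
qed

text \<open>Someone with two partners misses \<open>hold x\<close> in one of the matchings. There
  \<open>hold x\<close> is still matched, to someone else, and is thus improvable;
  \<open>hold\<close> is injective.\<close>

lemma card_multi_men:
  assumes le: "card X \<le> card Y" and A: "A \<subseteq> X"
    and ex: "\<And>x. x \<in> A \<Longrightarrow> \<exists>L1 L2 y1 y2. lstable L1 \<and> lstable L2 \<and> (x, y1) \<in> L1 \<and> (x, y2) \<in> L2 \<and> y1 \<noteq> y2"
  shows "card A \<le> card improvable"
proof (rule card_inj_on_le[OF _ _ improvable_fin])
  show "inj_on hold A" using hold_bij[OF le] A unfolding bij_betw_def by (auto intro: inj_on_subset)
  show "hold ` A \<subseteq> improvable"
  proof
    fix y assume "y \<in> hold ` A"
    then obtain x where x: "x \<in> A" "y = hold x" by auto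
    then have xX: "x \<in> X" using A by auto
    obtain L y1 where L: "lstable L" "(x, y1) \<in> L" "y1 \<noteq> y" using ex[OF x(1)] by metis
    have "y \<in> reached" using hold_bij[OF le] xX x(2) by (auto simp: bij_betw_def)
    then obtain x' where x': "(x', y) \<in> L" using reached_matched[OF L(1)] by blast
    have "x' \<noteq> x" using lstable_fun[OF L(1)] L x' by blast
    then show "y \<in> improvable" using in_improvable[OF le _ _ L(1) x'] hold[OF le xX] x(2) by blast
  qed
qed

lemma card_unproposed: "card X \<le> card Y \<Longrightarrow> card (Y - reached) = card Y - card X"
  using card_reached reached_sub finY by (simp add: card_Diff_subset finite_subset)

text \<open>Members of \<open>Y\<close> outside \<open>reached\<close> find partners outside the
  class in the full market, where nothing is known about them. They are simply all counted, and
  \<open>ex\<close> is required only on \<open>reached\<close>.\<close>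

lemma card_multi_women:
  assumes le: "card X \<le> card Y" and B: "B \<subseteq> Y"
    and ex: "\<And>y. y \<in> B \<Longrightarrow> y \<in> reached \<Longrightarrow> \<exists>L1 L2 x1 x2. lstable L1 \<and> lstable L2 \<and> (x1, y) \<in> L1 \<and> (x2, y) \<in> L2 \<and> x1 \<noteq> x2"
  shows "card B \<le> card improvable + (card Y - card X)"
proof -
  have "B \<subseteq> improvable \<union> (Y - reached)"
  proof
    fix y assume y: "y \<in> B"
    show "y \<in> improvable \<union> (Y - reached)"
    proof (cases "y \<in> reached")
      case True
      then obtain x0 where "P x0 y" unfolding reached_def by auto
      then obtain x0 where x0: "P x0 y" "\<not> R x0 y" using holder_ex by blast
      obtain L x where "lstable L" "(x, y) \<in> L" "x \<noteq> x0" using ex[OF y True] by metis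
      then show ?thesis using in_improvable[OF le x0] by blast
    qed (use y B in auto)
  qed
  then have "card B \<le> card (improvable \<union> (Y - reached))" using improvable_fin finY by (intro card_mono) auto
  also have "\<dots> \<le> card improvable + card (Y - reached)" by (rule card_Un_le)
  finally show ?thesis using card_unproposed[OF le] by simp
qed

text \<open>Exchanges \<open>y0\<close> and \<open>u\<close> in the lists of those who have not reached \<open>y0\<close>; for \<open>u\<close> without proposals
  the exchange stays invisible to the ordinary process and redirects the chain from \<open>y0\<close> to \<open>u\<close>.\<close>

definition tail_swap :: "'b \<Rightarrow> 'b \<Rightarrow> 'a \<Rightarrow> 'b \<Rightarrow> nat" where
  "tail_swap y0 u = (\<lambda>x. if x \<in> X \<and> \<not> P x y0 then f x \<circ> Transposition.transpose y0 u else f x)"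

context
  fixes y0 u assumes y0: "y0 \<in> Y" and u: "u \<in> Y - reached"
begin

abbreviation "f' \<equiv> tail_swap y0 u"

lemma transpose_Y: "Transposition.transpose y0 u y \<in> Y \<longleftrightarrow> y \<in> Y"
  using y0 u by (auto simp: Transposition.transpose_def)

lemma noPu: "\<not> P x u" using u unfolding reached_def by auto

lemma noRu: "\<not> R x u" using noPu unfolding rejects_def by auto

lemma proposes_tail_swap1:
  assumes "P x y" shows "proposes X Y f' g {} {} x y"
  using assms
proof (induction rule: proposes.induct)
  case (proposesI x y)
  have P: "P x y" by (rule proposes.proposesI) (use proposesI in auto)
  show ?case
  proof (rule proposes.proposesI)
    fix y' assume y': "y' \<in> Y" "f' x y' < f' x y"
    have "y' \<in> Y \<and> f x y' < f x y"
    proof (cases "P x y0")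
      case False
      have "y \<noteq> y0" "y \<noteq> u" using P False noPu by auto
      then have lt: "f x (Transposition.transpose y0 u y') < f x y" "Transposition.transpose y0 u y' \<in> Y"
        using y' False proposesI(1) transpose_Y by (auto simp: tail_swap_def)
      have "P x (Transposition.transpose y0 u y')" using proposes_better(1)[OF P lt(2,1)] .
      then have "Transposition.transpose y0 u y' = y'" using False noPu by (auto simp: Transposition.transpose_def split: if_splits)
      then show ?thesis using lt by simp
    qed (use y' in \<open>auto simp: tail_swap_def\<close>)
    then show "(x, y') \<in> {} \<or> y' \<notin> {} \<and> (\<exists>x'. proposes X Y f' g {} {} x' y' \<and> g y' x' < g y' x)"
      using proposesI(3)[of y'] by blast
  qed (use proposesI in auto)
qed

text \<open>This is not the first direction applied to \<open>f'\<close>, since that would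
  presuppose that \<open>u\<close> has no proposals under \<open>f'\<close>.\<close>

lemma proposes_tail_swap2:
  assumes "proposes X Y f' g {} {} x y" shows "P x y"
  using assms
proof (induction rule: proposes.induct)
  case (proposesI x y)
  have R: "R x y'" if "y' \<in> Y" "f' x y' < f' x y" for y'
    using proposesI(3)[OF that] unfolding rejects_def by auto
  show ?case
  proof (cases "P x y0")
    case True
    then have "f' x = f x" by (simp add: tail_swap_def)
    then show ?thesis using R proposesI(1,2) by (simp add: proposes_iff[of _ _ _ _ _ _ x y])
  next
    case False
    have f': "f' x z = f x (Transposition.transpose y0 u z)" for z using False proposesI(1) by (simp add: tail_swap_def)
    \<comment> \<open>If \<open>x\<close> got as far as \<open>z\<close> under \<open>f'\<close>,
      then exchanging \<open>y0\<close> and \<open>u\<close> back shows that \<open>x\<close>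
      proposes to one of them under \<open>f\<close>, which never happens. Condition
      \<open>w\<close> says that \<open>z\<close> is not preceded by \<open>y0\<close> when
      \<open>z = u\<close>.\<close>
    have key1: False if a: "\<And>y'. y' \<in> Y \<Longrightarrow> f' x y' < f' x z \<Longrightarrow> R x y'" and z: "z = y0 \<or> z = u"
      and w: "z = u \<Longrightarrow> \<not> f' x y0 < f' x u" for z
    proof -
      have "P x (Transposition.transpose y0 u z)"
        unfolding proposes_iff[of _ _ _ _ _ _ x]
      proof (intro conjI ballI impI)
        show "x \<in> X" "Transposition.transpose y0 u z \<in> Y" using proposesI(1) y0 u z by auto
        fix y' assume y': "y' \<in> Y" "f x y' < f x (Transposition.transpose y0 u z)"
        then have "f' x (Transposition.transpose y0 u y') < f' x z" by (simp add: f')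
        then have R': "R x (Transposition.transpose y0 u y')" "Transposition.transpose y0 u y' \<noteq> z"
          using a transpose_Y y' by auto
        show "R x y'"
        proof (cases "y' = y0")
          case True
          then show ?thesis using R' noRu by simp
        next
          case n: False
          show ?thesis
          proof (cases "y' = u")
            case True
            then have "z = u" using R' z by auto
            then show ?thesis using y' True w by (simp add: f')
          qed (use n R' in \<open>simp add: Transposition.transpose_def\<close>)
        qed
      qed
      moreover have "\<not> P x (Transposition.transpose y0 u z)" using z noPu False by auto
      ultimately show False by simp
    qed
    \<comment> \<open>If \<open>y0\<close> precedes \<open>u\<close> in the exchanged list, the
      argument is applied to \<open>y0\<close> instead.\<close>
    have key: False if a: "\<And>y'. y' \<in> Y \<Longrightarrow> f' x y' < f' x z \<Longrightarrow> R x y'" and z: "z = y0 \<or> z = u" for z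
    proof (cases "z = u \<and> f' x y0 < f' x u")
      case True
      show ?thesis by (rule key1[of y0]) (use a True y0 u in auto)
    next
      case False
      show ?thesis by (rule key1[OF a z]) (use False in auto)
    qed
    have ny: "y \<noteq> y0" "y \<noteq> u" using key[of y] R by auto
    show ?thesis
      unfolding proposes_iff[of _ _ _ _ _ _ x]
    proof (intro conjI ballI impI)
      fix y' assume y': "y' \<in> Y" "f x y' < f x y"
      define z where "z = Transposition.transpose y0 u y'"
      have z: "f' x z < f' x y" "z \<in> Y" using y' ny transpose_Y by (auto simp: f' z_def)
      have "z \<noteq> y0 \<and> z \<noteq> u"
        using key[of z] R order.strict_trans[OF _ z(1)] by blast
      then have "z = y'" unfolding z_def by (auto simp: Transposition.transpose_def split: if_splits)
      then show "R x y'" using R z by auto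
    qed (use proposesI in auto)
  qed
qed

lemma proposes_tail_swap: "proposes X Y f' g {} {} = P"
  using proposes_tail_swap1 proposes_tail_swap2 by blast

lemma market_tail_swap: "market X Y f' g"
proof
  show "inj_on (f' x) Y" if "x \<in> X" for x
  proof (cases "P x y0")
    case False
    have "inj_on (f x \<circ> Transposition.transpose y0 u) Y"
      by (rule comp_inj_on) (use injf[OF that] y0 u in \<open>auto simp: inj_on_def transpose_eq_iff\<close>)
    then show ?thesis using that False by (simp add: tail_swap_def)
  qed (use injf[OF that] in \<open>simp add: tail_swap_def\<close>)
qed (use finX finY injg in auto)

lemma reached_tail_swap: "market.reached X Y f' g = reached"
  unfolding market.reached_def[OF market_tail_swap] reached_def proposes_tail_swap ..

text \<open>The chain is copied with \<open>y0\<close> and \<open>u\<close> exchanged for those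
  whose lists were changed. As it returns to \<open>y0\<close>, it never touches \<open>u\<close> by
  \<open>gains_unique\<close>, so the exchange only diverts the last proposal from \<open>y0\<close>
  to \<open>u\<close>.\<close>

lemma gains_tail_swap:
  assumes le: "card X \<le> card Y" and y0V: "y0 \<in> reached" and O: "gains y0 y0"
  shows "market.gains X Y f' g y0 u"
proof -
  interpret m': market X Y f' g by (rule market_tail_swap)
  let ?F = "{x. P x y0} \<times> {y0}"
  have nu: "\<not> pr2 y0 x u" for x
    using gains_unique[OF le y0V, of y0 u] O u y0V noPu unfolding gains_def by auto
  have "proposes X Y f' g {y0} ?F x (if P x y0 then y else Transposition.transpose y0 u y)"
    if "pr2 y0 x y" for x y
    using that unfolding pr2_def
  proof (induction rule: proposes.induct)
    case (proposesI x y)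
    have Q: "pr2 y0 x y" unfolding pr2_def by (rule proposes.proposesI) (use proposesI in auto)
    have S: "(x, y') \<in> ?F \<or> y' \<notin> {y0} \<and> (\<exists>x'. proposes X Y f' g {y0} ?F x' y' \<and> g y' x' < g y' x)"
      if y': "y' \<in> Y" "f x y' < f x y" for y'
    proof (cases "y' = y0")
      case True
      then show ?thesis using proposesI(3)[OF y'] by auto
    next
      case False
      have "pr2 y0 x y'" using proposes_better(1)[OF Q[unfolded pr2_def] y'] unfolding pr2_def .
      then have "y' \<noteq> u" using nu by auto
      then have "Transposition.transpose y0 u y' = y'" using False by (simp add: Transposition.transpose_def)
      then show ?thesis using proposesI(3)[OF y'] False by (auto split: if_splits)
    qed
    show ?case
    proof (rule proposes.proposesI)
      show "x \<in> X" by fact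
      show "(if P x y0 then y else Transposition.transpose y0 u y) \<in> Y" using proposesI(2) transpose_Y by auto
      fix y' assume y': "y' \<in> Y" "f' x y' < f' x (if P x y0 then y else Transposition.transpose y0 u y)"
      show "(x, y') \<in> ?F \<or> y' \<notin> {y0} \<and> (\<exists>x'. proposes X Y f' g {y0} ?F x' y' \<and> g y' x' < g y' x)"
      proof (cases "P x y0")
        case True
        then show ?thesis using S y' by (simp add: tail_swap_def)
      next
        case False
        let ?z = "Transposition.transpose y0 u y'"
        have z: "?z \<in> Y" "f x ?z < f x y" using y' False proposesI(1) transpose_Y by (auto simp: tail_swap_def)
        have "pr2 y0 x ?z" using proposes_better(1)[OF Q[unfolded pr2_def] z] unfolding pr2_def .
        then have "?z \<noteq> u" using nu by metis
        moreover have "?z \<noteq> y0" using S[OF z] False by auto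
        ultimately have "?z = y'" by (auto simp: Transposition.transpose_def split: if_splits)
        then show ?thesis using S[OF z] by simp
      qed
    qed
  qed
  moreover obtain x where x: "pr2 y0 x y0" "\<not> P x y0" using O unfolding gains_def by auto
  ultimately have "proposes X Y f' g {y0} ?F x (if P x y0 then y0 else Transposition.transpose y0 u y0)" by blast
  then have "proposes X Y f' g {y0} ?F x u" using x(2) by simp
  then show ?thesis
    unfolding m'.gains_def m'.pr2_def proposes_tail_swap using noPu by blast
qed

text \<open>The exchange depends on \<open>f\<close> only through \<open>P\<close>, which it
  preserves, so repeating it undoes it. Injectivity of the map in the count below rests on
  this.\<close>

lemma tail_swap_cancel:
  "f = (\<lambda>x. if x \<in> X \<and> \<not> P x y0 then f' x \<circ> Transposition.transpose y0 u else f' x)"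
  by (auto simp: tail_swap_def fun_eq_iff)

end

end

text \<open>Each system of lists in which \<open>y0\<close> is improvable yields one exchanged
  system for each of the \<open>card Y - card X\<close> members \<open>u\<close> without proposals.
  From the result \<open>u\<close> is recovered as the unique end of the chain, and then
  \<open>f\<close> by exchanging back. In all these systems \<open>y0\<close> is not improvable, so
  they are disjoint from the original ones.\<close>

lemma card_improvable_le:
  assumes m: "\<And>f. f \<in> \<Omega> \<Longrightarrow> market X Y f g" and fin: "finite \<Omega>"
    and le: "card X \<le> card Y" and y0: "y0 \<in> Y"
    and closed: "\<And>f S u. f \<in> \<Omega> \<Longrightarrow> S \<subseteq> X \<Longrightarrow> u \<in> Y \<Longrightarrow>
      (\<lambda>x. if x \<in> S then f x \<circ> Transposition.transpose y0 u else f x) \<in> \<Omega>"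
  shows "(card Y - card X + 1) * card {f \<in> \<Omega>. y0 \<in> market.improvable X Y f g} \<le> card \<Omega>"
proof -
  let ?S = "{f \<in> \<Omega>. y0 \<in> market.improvable X Y f g}"
  let ?T = "SIGMA f:?S. Y - market.reached X Y f g"
  define \<phi> where "\<phi> = (\<lambda>(f, u). market.tail_swap X Y f g y0 u)"
  have improvable: "y0 \<in> market.improvable X Y f g \<longleftrightarrow> y0 \<in> market.reached X Y f g \<and> market.gains X Y f g y0 y0" if "f \<in> \<Omega>" for f
    using market.improvable_def[OF m[OF that]] by simp
  have fS: "finite ?S" using fin by auto
  have ne: "u \<noteq> y0" if "(f, u) \<in> ?T" for f u
    using that improvable by auto
  have props: "\<phi> (f, u) \<in> \<Omega>" "proposes X Y (\<phi> (f, u)) g {} {} = proposes X Y f g {} {}"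
    "market.reached X Y (\<phi> (f, u)) g = market.reached X Y f g" "market.gains X Y (\<phi> (f, u)) g y0 u"
    "y0 \<in> market.reached X Y f g" "u \<in> Y - market.reached X Y f g"
    "f = (\<lambda>x. if x \<in> X \<and> \<not> proposes X Y f g {} {} x y0 then \<phi> (f, u) x \<circ> Transposition.transpose y0 u else \<phi> (f, u) x)"
    if fu: "(f, u) \<in> ?T" for f u
  proof -
    from fu have f: "f \<in> \<Omega>" "y0 \<in> market.reached X Y f g" "market.gains X Y f g y0 y0" and u: "u \<in> Y - market.reached X Y f g"
      using improvable by auto
    interpret market X Y f g by (rule m[OF f(1)])
    have "(\<lambda>x. if x \<in> {x\<in>X. \<not> P x y0} then f x \<circ> Transposition.transpose y0 u else f x) \<in> \<Omega>"
      by (rule closed) (use f u in auto)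
    then show "\<phi> (f, u) \<in> \<Omega>" by (simp add: \<phi>_def tail_swap_def)
    show "proposes X Y (\<phi> (f, u)) g {} {} = P" using proposes_tail_swap[OF y0 u] by (simp add: \<phi>_def)
    show "market.reached X Y (\<phi> (f, u)) g = reached" using reached_tail_swap[OF y0 u] by (simp add: \<phi>_def)
    show "market.gains X Y (\<phi> (f, u)) g y0 u" using gains_tail_swap[OF y0 u le f(2,3)] by (simp add: \<phi>_def)
    show "y0 \<in> reached" "u \<in> Y - reached" by fact+
    show "f = (\<lambda>x. if x \<in> X \<and> \<not> P x y0 then \<phi> (f, u) x \<circ> Transposition.transpose y0 u else \<phi> (f, u) x)"
      unfolding \<phi>_def prod.case by (rule tail_swap_cancel[OF y0 u])
  qed
  have inj: "inj_on \<phi> ?T"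
  proof (rule inj_onI, clarify)
    fix f1 u1 f2 u2
    assume t1: "f1 \<in> \<Omega>" "y0 \<in> market.improvable X Y f1 g" "u1 \<in> Y" "u1 \<notin> market.reached X Y f1 g"
      and t2: "f2 \<in> \<Omega>" "y0 \<in> market.improvable X Y f2 g" "u2 \<in> Y" "u2 \<notin> market.reached X Y f2 g"
      and eq: "\<phi> (f1, u1) = \<phi> (f2, u2)"
    have T1: "(f1, u1) \<in> ?T" and T2: "(f2, u2) \<in> ?T" using t1 t2 by auto
    note p1 = props[OF T1] and p2 = props[OF T2]
    interpret m': market X Y "\<phi> (f1, u1)" g by (rule m[OF p1(1)])
    have u: "u1 = u2"
      by (rule m'.gains_unique[OF le, of y0]) (use p1 p2 eq in auto)
    have "f1 = f2" using p1(7) p2(7) p1(2) p2(2) eq u by metis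
    with u show "f1 = f2 \<and> u1 = u2" by simp
  qed
  have img: "\<phi> ` ?T \<subseteq> \<Omega> - ?S"
  proof
    fix f' assume "f' \<in> \<phi> ` ?T"
    then obtain f u where fu: "(f, u) \<in> ?T" "f' = \<phi> (f, u)" by auto
    note p = props[OF fu(1)]
    interpret m': market X Y f' g using m[OF p(1)] fu by simp
    have "\<not> m'.gains y0 y0" using m'.gains_unique[OF le, of y0 y0 u] p fu ne[OF fu(1)] by auto
    then have "f' \<notin> ?S" using m'.improvable_def by auto
    then show "f' \<in> \<Omega> - ?S" using p fu by auto
  qed
  have "card ?T = (\<Sum>f\<in>?S. card (Y - market.reached X Y f g))"
  proof (rule card_SigmaI[OF fS], rule ballI)
    fix f assume "f \<in> ?S"
    then show "finite (Y - market.reached X Y f g)" using market.finY[OF m] by auto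
  qed
  also have "\<dots> = (\<Sum>f\<in>?S. card Y - card X)"
    by (rule sum.cong) (use market.card_unproposed[OF m] le in auto)
  finally have "card ?T = (card Y - card X) * card ?S" by simp
  moreover have "card ?T \<le> card (\<Omega> - ?S)" using card_inj_on_le[OF inj img] fin by simp
  moreover have "card (\<Omega> - ?S) = card \<Omega> - card ?S" using fin by (intro card_Diff_subset) auto
  moreover have "card ?S \<le> card \<Omega>" using fin by (intro card_mono) auto
  ultimately show ?thesis by simp
qed

section \<open>Averages and variances over finite sets\<close>

definition avg :: "'a set \<Rightarrow> ('a \<Rightarrow> real) \<Rightarrow> real" where
  "avg S f = (\<Sum>x\<in>S. f x) / card S"

definition variance_on :: "'a set \<Rightarrow> ('a \<Rightarrow> real) \<Rightarrow> real" where
  "variance_on S f = avg S (\<lambda>x. (f x - avg S f)\<^sup>2)"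

lemma avg_cong: "(\<And>x. x \<in> S \<Longrightarrow> f x = g x) \<Longrightarrow> avg S f = avg S g"
  by (simp add: avg_def)

lemma avg_mono: "(\<And>x. x \<in> S \<Longrightarrow> f x \<le> g x) \<Longrightarrow> avg S f \<le> avg S g"
  by (simp add: avg_def sum_mono divide_right_mono)

lemma avg_nonneg: "(\<And>x. x \<in> S \<Longrightarrow> 0 \<le> f x) \<Longrightarrow> 0 \<le> avg S f"
  by (simp add: avg_def sum_nonneg)

lemma avg_add: "avg S (\<lambda>x. f x + g x) = avg S f + avg S g"
  by (simp add: avg_def sum.distrib add_divide_distrib)

lemma avg_diff: "avg S (\<lambda>x. f x - g x) = avg S f - avg S g"
  by (simp add: avg_def sum_subtractf diff_divide_distrib)

lemma avg_cmult: "avg S (\<lambda>x. c * f x) = c * avg S f"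
  by (simp add: avg_def sum_distrib_left)

lemma avg_sum: "avg S (\<lambda>x. \<Sum>i\<in>I. f i x) = (\<Sum>i\<in>I. avg S (f i))"
  by (simp add: avg_def sum.swap[of _ S] sum_divide_distrib)

lemma avg_const: "finite S \<Longrightarrow> S \<noteq> {} \<Longrightarrow> avg S (\<lambda>x. c) = c"
  by (simp add: avg_def)

lemma avg_le_const: "finite S \<Longrightarrow> S \<noteq> {} \<Longrightarrow> (\<And>x. x \<in> S \<Longrightarrow> f x \<le> c) \<Longrightarrow> avg S f \<le> c"
  using avg_mono[of S f "\<lambda>_. c"] avg_const[of S c] by simp

lemma avg_abs: "\<bar>avg S f\<bar> \<le> avg S (\<lambda>x. \<bar>f x\<bar>)"
  by (simp add: avg_def abs_divide divide_right_mono)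

lemma avg_image: "inj_on h S \<Longrightarrow> avg (h ` S) f = avg S (\<lambda>x. f (h x))"
  by (simp add: avg_def sum.reindex card_image)

lemma avg_Times: "avg (A \<times> B) f = avg A (\<lambda>a. avg B (\<lambda>b. f (a, b)))"
proof -
  have "sum f (A \<times> B) = (\<Sum>a\<in>A. \<Sum>b\<in>B. f (a, b))" by (simp add: sum.cartesian_product)
  then show ?thesis
    by (simp add: avg_def card_cartesian_product sum_divide_distrib[symmetric] mult.commute)
qed

lemma avg_swap: "avg A (\<lambda>a. avg B (\<lambda>b. f a b)) = avg B (\<lambda>b. avg A (\<lambda>a. f a b))"
  by (simp add: avg_def sum_divide_distrib[symmetric] sum.swap[of _ A] mult.commute)

lemma avg_indicator: "finite S \<Longrightarrow> avg S (\<lambda>x. of_bool (Q x)) = card {x \<in> S. Q x} / card S"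
  by (simp add: avg_def sum.If_cases Int_def of_bool_def)

lemma variance_on_alt:
  assumes "finite S" "S \<noteq> {}"
  shows "variance_on S f = avg S (\<lambda>x. (f x)\<^sup>2) - (avg S f)\<^sup>2"
proof -
  define m where "m = avg S f"
  have "variance_on S f = avg S (\<lambda>x. ((f x)\<^sup>2 - (2 * m) * f x) + m\<^sup>2)"
    unfolding variance_on_def m_def[symmetric] by (simp add: power2_diff algebra_simps)
  also have "\<dots> = avg S (\<lambda>x. (f x)\<^sup>2) - 2 * m * m + m\<^sup>2"
    unfolding avg_add avg_diff avg_cmult avg_const[OF assms] m_def ..
  finally show ?thesis unfolding m_def by (simp add: power2_eq_square)
qed

lemma variance_on_image: "inj_on h S \<Longrightarrow> variance_on (h ` S) f = variance_on S (\<lambda>x. f (h x))"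
  by (simp add: variance_on_def avg_image)

text \<open>The law of total variance.\<close>

lemma variance_on_Times:
  assumes "finite A" "A \<noteq> {}" "finite B" "B \<noteq> {}"
  shows "variance_on (A \<times> B) f = avg A (\<lambda>a. variance_on B (\<lambda>b. f (a, b))) + variance_on A (\<lambda>a. avg B (\<lambda>b. f (a, b)))"
proof -
  have "variance_on (A \<times> B) f = avg A (\<lambda>a. avg B (\<lambda>b. (f (a, b))\<^sup>2)) - (avg A (\<lambda>a. avg B (\<lambda>b. f (a, b))))\<^sup>2"
    using variance_on_alt[of "A \<times> B" f] assms by (simp add: avg_Times)
  also have "\<dots> = avg A (\<lambda>a. variance_on B (\<lambda>b. f (a, b))) + variance_on A (\<lambda>a. avg B (\<lambda>b. f (a, b)))"
    using assms by (simp add: variance_on_alt avg_diff)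
  finally show ?thesis .
qed

lemma variance_on_le:
  fixes c :: real
  assumes "finite S" "S \<noteq> {}" "0 \<le> c" "\<And>x y. x \<in> S \<Longrightarrow> y \<in> S \<Longrightarrow> \<bar>f x - f y\<bar> \<le> c"
  shows "variance_on S f \<le> c\<^sup>2"
  unfolding variance_on_def
proof (rule avg_le_const[OF assms(1,2)])
  fix x assume x: "x \<in> S"
  have "f x - avg S f = avg S (\<lambda>y. f x - f y)" using assms by (simp add: avg_diff avg_const)
  also have "\<bar>\<dots>\<bar> \<le> avg S (\<lambda>y. \<bar>f x - f y\<bar>)" by (rule avg_abs)
  also have "\<dots> \<le> c" using assms x by (intro avg_le_const) auto
  finally show "(f x - avg S f)\<^sup>2 \<le> c\<^sup>2" by (simp add: abs_le_square_iff[symmetric] assms(3))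
qed

definition lip :: "'i set \<Rightarrow> ('i \<Rightarrow> 'v set) \<Rightarrow> real \<Rightarrow> (('i \<Rightarrow> 'v) \<Rightarrow> real) \<Rightarrow> bool" where
  "lip I S c f \<longleftrightarrow> (\<forall>\<phi>\<in>Pi\<^sub>E I S. \<forall>i\<in>I. \<forall>v\<in>S i. \<bar>f \<phi> - f (\<phi>(i := v))\<bar> \<le> c)"

lemma lip_avg:
  assumes "finite B" "B \<noteq> {}" "\<And>b. b \<in> B \<Longrightarrow> lip I S c (\<lambda>a. f a b)"
  shows "lip I S c (\<lambda>a. avg B (f a))"
  unfolding lip_def
proof (intro ballI)
  fix \<phi> i v assume a: "\<phi> \<in> Pi\<^sub>E I S" "i \<in> I" "v \<in> S i"
  have "\<bar>avg B (f \<phi>) - avg B (f (\<phi>(i := v)))\<bar> = \<bar>avg B (\<lambda>b. f \<phi> b - f (\<phi>(i := v)) b)\<bar>"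
    by (simp add: avg_diff)
  also have "\<dots> \<le> avg B (\<lambda>b. \<bar>f \<phi> b - f (\<phi>(i := v)) b\<bar>)" by (rule avg_abs)
  also have "\<dots> \<le> c" using assms a unfolding lip_def by (intro avg_le_const) auto
  finally show "\<bar>avg B (f \<phi>) - avg B (f (\<phi>(i := v)))\<bar> \<le> c" .
qed

lemma avg_PiE_insert:
  assumes "i \<notin> I"
  shows "avg (Pi\<^sub>E (insert i I) S) f = avg (S i \<times> Pi\<^sub>E I S) (\<lambda>(v, \<phi>). f (\<phi>(i := v)))"
  unfolding PiE_insert_eq using inj_combinator[OF assms] by (subst avg_image) (simp_all add: case_prod_beta')

lemma variance_on_PiE_insert:
  assumes "i \<notin> I"
  shows "variance_on (Pi\<^sub>E (insert i I) S) f = variance_on (S i \<times> Pi\<^sub>E I S) (\<lambda>(v, \<phi>). f (\<phi>(i := v)))"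
  unfolding PiE_insert_eq using inj_combinator[OF assms] by (subst variance_on_image) (simp_all add: case_prod_beta')

text \<open>Efron-Stein: each coordinate contributes at most \<open>c\<^sup>2\<close> to the variance.\<close>

lemma variance_on_lip:
  fixes c :: real
  assumes "finite I" "\<And>i. i \<in> I \<Longrightarrow> finite (S i) \<and> S i \<noteq> {}" "0 \<le> c" "lip I S c f"
  shows "variance_on (Pi\<^sub>E I S) f \<le> card I * c\<^sup>2"
  using assms
proof (induction I arbitrary: f rule: finite_induct)
  case empty
  then show ?case by (simp add: variance_on_def avg_def)
next
  case (insert i I)
  let ?P = "Pi\<^sub>E I S"
  have P: "finite ?P" "?P \<noteq> {}" using insert by (auto simp: PiE_eq_empty_iff intro!: finite_PiE)
  have Si: "finite (S i)" "S i \<noteq> {}" using insert by auto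
  have up: "\<phi>(i := v) \<in> Pi\<^sub>E (insert i I) S" if "\<phi> \<in> ?P" "v \<in> S i" for \<phi> v
    using that by (auto simp: PiE_def Pi_def extensional_def)
  have "variance_on (Pi\<^sub>E (insert i I) S) f
      = avg (S i) (\<lambda>v. variance_on ?P (\<lambda>\<phi>. f (\<phi>(i := v)))) + variance_on (S i) (\<lambda>v. avg ?P (\<lambda>\<phi>. f (\<phi>(i := v))))"
    using variance_on_PiE_insert[OF insert(2), of S f] variance_on_Times[OF Si P, of "\<lambda>(v, \<phi>). f (\<phi>(i := v))"] by simp
  also have "\<dots> \<le> card I * c\<^sup>2 + c\<^sup>2"
  proof (rule add_mono)
    show "avg (S i) (\<lambda>v. variance_on ?P (\<lambda>\<phi>. f (\<phi>(i := v)))) \<le> card I * c\<^sup>2"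
    proof (rule avg_le_const[OF Si])
      fix v assume v: "v \<in> S i"
      have "lip I S c (\<lambda>\<phi>. f (\<phi>(i := v)))"
        unfolding lip_def
      proof (intro ballI)
        fix \<phi> j w assume a: "\<phi> \<in> ?P" "j \<in> I" "w \<in> S j"
        then have "j \<noteq> i" using insert by auto
        then have "(\<phi>(j := w))(i := v) = (\<phi>(i := v))(j := w)" by (simp add: fun_upd_twist)
        then show "\<bar>f (\<phi>(i := v)) - f ((\<phi>(j := w))(i := v))\<bar> \<le> c"
          using insert.prems(3) up[OF a(1) v] a unfolding lip_def by simp
      qed
      then show "variance_on ?P (\<lambda>\<phi>. f (\<phi>(i := v))) \<le> card I * c\<^sup>2" using insert by auto
    qed
    \<comment> \<open>Averaging over the other coordinates does not increase the influence of
      coordinate \<open>i\<close>, so a function of one variable with oscillation at most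
      \<open>c\<close> remains.\<close>
    show "variance_on (S i) (\<lambda>v. avg ?P (\<lambda>\<phi>. f (\<phi>(i := v)))) \<le> c\<^sup>2"
    proof (rule variance_on_le[OF Si insert.prems(2)])
      fix x y assume xy: "x \<in> S i" "y \<in> S i"
      have "\<bar>avg ?P (\<lambda>\<phi>. f (\<phi>(i := x))) - avg ?P (\<lambda>\<phi>. f (\<phi>(i := y)))\<bar>
        \<le> avg ?P (\<lambda>\<phi>. \<bar>f (\<phi>(i := x)) - f (\<phi>(i := y))\<bar>)"
        unfolding avg_diff[symmetric] by (rule avg_abs)
      also have "\<dots> \<le> c"
      proof (rule avg_le_const[OF P])
        fix \<phi> assume a: "\<phi> \<in> ?P"
        have "\<bar>f (\<phi>(i := x)) - f ((\<phi>(i := x))(i := y))\<bar> \<le> c"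
          using insert.prems(3) up[OF a xy(1)] xy(2) unfolding lip_def by blast
        then show "\<bar>f (\<phi>(i := x)) - f (\<phi>(i := y))\<bar> \<le> c" by simp
      qed
      finally show "\<bar>avg ?P (\<lambda>\<phi>. f (\<phi>(i := x))) - avg ?P (\<lambda>\<phi>. f (\<phi>(i := y)))\<bar> \<le> c" .
    qed
  qed
  also have "\<dots> = card (insert i I) * c\<^sup>2" using insert by (simp add: algebra_simps)
  finally show ?case .
qed

text \<open>Peels off one component of a configuration at a time; the components have different
  types, so they are not coordinates of a single function space.\<close>

lemma variance_on_Times_lip:
  fixes c K :: real
  assumes "finite I" "\<And>i. i \<in> I \<Longrightarrow> finite (S i) \<and> S i \<noteq> {}" "finite B" "B \<noteq> {}" "0 \<le> c"
    and "\<And>b. b \<in> B \<Longrightarrow> lip I S c (\<lambda>a. f (a, b))"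
    and "\<And>a. a \<in> Pi\<^sub>E I S \<Longrightarrow> variance_on B (\<lambda>b. f (a, b)) \<le> K"
  shows "variance_on (Pi\<^sub>E I S \<times> B) f \<le> card I * c\<^sup>2 + K"
proof -
  have P: "finite (Pi\<^sub>E I S)" "Pi\<^sub>E I S \<noteq> {}" using assms by (auto simp: PiE_eq_empty_iff intro!: finite_PiE)
  have "variance_on (Pi\<^sub>E I S) (\<lambda>a. avg B (\<lambda>b. f (a, b))) \<le> card I * c\<^sup>2"
    using assms by (intro variance_on_lip lip_avg) auto
  moreover have "avg (Pi\<^sub>E I S) (\<lambda>a. variance_on B (\<lambda>b. f (a, b))) \<le> K"
    using assms by (intro avg_le_const[OF P]) auto
  ultimately show ?thesis using variance_on_Times[OF P assms(3,4)] by simp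
qed

lemma chebyshev:
  assumes "finite S" "S \<noteq> {}" "0 < t"
  shows "card {x \<in> S. f x \<le> avg S f - t} / card S \<le> variance_on S f / t\<^sup>2"
proof -
  have "avg S (\<lambda>x. t\<^sup>2 * of_bool (f x \<le> avg S f - t)) \<le> variance_on S f"
    unfolding variance_on_def
  proof (rule avg_mono)
    fix x assume "x \<in> S"
    show "t\<^sup>2 * of_bool (f x \<le> avg S f - t) \<le> (f x - avg S f)\<^sup>2"
    proof (cases "f x \<le> avg S f - t")
      case True
      then have "\<bar>t\<bar> \<le> \<bar>f x - avg S f\<bar>" using assms(3) by auto
      then show ?thesis using True by (simp only: abs_le_square_iff) simp
    qed auto
  qed
  then show ?thesis using assms by (simp add: avg_cmult avg_indicator field_simps)
qed

lemma markov:
  assumes "finite S" "\<And>x. x \<in> S \<Longrightarrow> 0 \<le> f x" "0 < t"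
  shows "card {x \<in> S. t < f x} / card S \<le> avg S f / t"
proof -
  have "avg S (\<lambda>x. t * of_bool (t < f x)) \<le> avg S f"
    by (rule avg_mono) (use assms in auto)
  then show ?thesis using assms by (simp add: avg_cmult avg_indicator field_simps)
qed

section \<open>Binomial weights\<close>

lemma Bernstein_Suc:
  "Bernstein (Suc n) (Suc j) q = q * Bernstein n j q + (1 - q) * Bernstein n (Suc j) q"
proof (cases "j < n")
  case True
  then have "n - j = Suc (n - Suc j)" by simp
  define X where "X = (1 - q) ^ (n - Suc j)"
  have e: "(1 - q) ^ (n - j) = (1 - q) * X" using \<open>n - j = Suc (n - Suc j)\<close> by (simp add: X_def)
  show ?thesis
    unfolding Bernstein_def diff_Suc_Suc e X_def[symmetric] by (simp add: algebra_simps)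
next
  case False
  then consider "j = n" | "n < j" by linarith
  then show ?thesis by cases (simp_all add: Bernstein_def binomial_eq_0)
qed

lemma Bernstein_0: "Bernstein (Suc n) 0 q = (1 - q) * Bernstein n 0 q"
  by (simp add: Bernstein_def)

lemma Bernstein_gt: "n < j \<Longrightarrow> Bernstein n j q = 0"
  by (simp add: Bernstein_def)

lemma sum_Bernstein_Suc:
  "(\<Sum>j\<le>Suc n. Bernstein (Suc n) j q * F j) =
   q * (\<Sum>j\<le>n. Bernstein n j q * F (Suc j)) + (1 - q) * (\<Sum>j\<le>n. Bernstein n j q * F j)"
proof -
  have "(\<Sum>j\<le>Suc n. Bernstein (Suc n) j q * F j) =
     Bernstein (Suc n) 0 q * F 0 + (\<Sum>j\<le>n. Bernstein (Suc n) (Suc j) q * F (Suc j))"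
    by (simp only: sum.atMost_Suc_shift)
  also have "\<dots> = q * (\<Sum>j\<le>n. Bernstein n j q * F (Suc j)) + (1 - q) * (Bernstein n 0 q * F 0 + (\<Sum>j\<le>n. Bernstein n (Suc j) q * F (Suc j)))"
    by (simp add: Bernstein_Suc Bernstein_0 sum.distrib sum_subtractf sum_distrib_left algebra_simps)
  also have "Bernstein n 0 q * F 0 + (\<Sum>j\<le>n. Bernstein n (Suc j) q * F (Suc j)) = (\<Sum>j\<le>Suc n. Bernstein n j q * F j)"
    by (simp only: sum.atMost_Suc_shift)
  also have "\<dots> = (\<Sum>j\<le>n. Bernstein n j q * F j)" by (simp add: Bernstein_gt)
  finally show ?thesis .
qed

text \<open>\<open>Bernstein n j q\<close> is the weight of \<open>j\<close> in the binomial
  distribution. \<open>F\<close> is arbitrary because the induction shifts its argument.\<close>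

lemma avg_count:
  assumes "finite Q" "p \<in> Q"
  shows "avg ({..<n} \<rightarrow>\<^sub>E Q) (\<lambda>a. F (card {i \<in> {..<n}. a i = p})) =
     (\<Sum>j\<le>n. Bernstein n j (1 / card Q) * F j)"
proof (induction n arbitrary: F)
  case 0
  then show ?case by (simp add: avg_def Bernstein_def)
next
  case (Suc n)
  define N where "N = real (card Q)"
  have N: "N > 0" using assms by (auto simp: N_def card_gt_0_iff)
  let ?P = "{..<n} \<rightarrow>\<^sub>E Q"
  let ?c = "\<lambda>a. card {i \<in> {..<n}. a i = p}"
  have cnt: "card {i \<in> {..<Suc n}. (a(n := v)) i = p} = (if v = p then Suc (?c a) else ?c a)" for a v
  proof -
    have "{i \<in> {..<Suc n}. (a(n := v)) i = p} = (if v = p then insert n {i \<in> {..<n}. a i = p} else {i \<in> {..<n}. a i = p})"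
      by (auto simp: less_Suc_eq)
    then show ?thesis by simp
  qed
  have ins: "avg ({..<Suc n} \<rightarrow>\<^sub>E Q) G = avg Q (\<lambda>v. avg ?P (\<lambda>a. G (a(n := v))))" for G
    by (simp add: lessThan_Suc avg_PiE_insert avg_Times)
  have "avg ({..<Suc n} \<rightarrow>\<^sub>E Q) (\<lambda>a. F (card {i \<in> {..<Suc n}. a i = p}))
     = avg Q (\<lambda>v. avg ?P (\<lambda>a. F (if v = p then Suc (?c a) else ?c a)))"
    by (simp only: ins cnt)
  also have "\<dots> = avg Q (\<lambda>v. if v = p then avg ?P (\<lambda>a. F (Suc (?c a))) else avg ?P (\<lambda>a. F (?c a)))"
    by (rule avg_cong) auto
  also have "\<dots> = (avg ?P (\<lambda>a. F (Suc (?c a))) + (N - 1) * avg ?P (\<lambda>a. F (?c a))) / N"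
  proof -
    have "real (card (Q - {p})) = N - 1" using assms N by (simp add: N_def card_Diff_singleton of_nat_diff)
    moreover have "(\<Sum>v\<in>Q - {p}. if v = p then avg ?P (\<lambda>a. F (Suc (?c a))) else avg ?P (\<lambda>a. F (?c a))) = (\<Sum>v\<in>Q - {p}. avg ?P (\<lambda>a. F (?c a)))"
      by (rule sum.cong) auto
    ultimately show ?thesis using assms by (simp add: avg_def[of Q] N_def sum.remove[of Q p])
  qed
  also have "\<dots> = (1 / N) * avg ?P (\<lambda>a. F (Suc (?c a))) + (1 - 1 / N) * avg ?P (\<lambda>a. F (?c a))"
    using N by (simp add: field_simps)
  also have "\<dots> = (\<Sum>j\<le>Suc n. Bernstein (Suc n) j (1 / N) * F j)"
    unfolding sum_Bernstein_Suc using Suc.IH[of F] Suc.IH[of "\<lambda>j. F (Suc j)"] by (simp add: N_def)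
  finally show ?case by (simp only: N_def)
qed

text \<open>The ratio of consecutive weights, free of division so that it stays true for
  \<open>n \<le> b\<close>, where both sides vanish.\<close>

lemma Bernstein_step:
  "real (Suc b) * (1 - q) * Bernstein n (Suc b) q = (real n - real b) * q * Bernstein n b q"
proof (cases "b < n")
  case True
  then have "n - b = Suc (n - Suc b)" by simp
  define X where "X = (1 - q) ^ (n - Suc b)"
  have e: "(1 - q) ^ (n - b) = (1 - q) * X" using \<open>n - b = Suc (n - Suc b)\<close> by (simp add: X_def)
  have "Suc b * (n choose Suc b) = (n - b) * (n choose b)"
    using binomial_absorption[of b n] binomial_absorb_comp[of n b] by simp
  then have K: "real (Suc b) * real (n choose Suc b) = (real n - real b) * real (n choose b)"
    using True by (metis of_nat_diff of_nat_mult less_imp_le)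
  show ?thesis
    unfolding Bernstein_def e X_def[symmetric]
    using arg_cong[OF K, of "\<lambda>t. t * ((1 - q) * q ^ b * q * X)"] by (simp only: mult_ac power_Suc)
next
  case False
  then consider "b = n" | "n < b" by linarith
  then show ?thesis by cases (simp_all add: Bernstein_def binomial_eq_0)
qed

text \<open>Below the mean plus \<open>J\<close>, consecutive weights decrease at most by a factor \<open>1 - (J + 1) / (n q (1 - q))\<close>,
  so a weight of size \<open>w\<close> is followed by \<open>J\<close> weights of size at least \<open>w / 2\<close>.\<close>

lemma Bernstein_lower_tail_le:
  assumes q: "0 < q" "q < 1" and J: "2 * real J * (real J + 1) \<le> n * q * (1 - q)" and b: "real b \<le> n * q"
  shows "Bernstein n b q \<le> 2 / (real J + 1)"
proof -
  define v where "v = n * q * (1 - q)"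
  define p where "p = (\<lambda>i. Bernstein n i q)"
  have p0: "p i \<ge> 0" for i using q by (simp add: p_def Bernstein_nonneg)
  show ?thesis
  proof (cases "J = 0")
    case True
    have "Bernstein n b q \<le> 1"
    proof (cases "b \<le> n")
      case True
      have "Bernstein n b q \<le> (\<Sum>i\<le>n. Bernstein n i q)"
        by (rule member_le_sum) (use True q in \<open>auto simp: Bernstein_nonneg\<close>)
      then show ?thesis by simp
    qed (simp add: Bernstein_gt)
    then show ?thesis using True by simp
  next
    case False
    have v: "v > 0" using J False unfolding v_def[symmetric]
      by (smt (verit) mult_pos_pos of_nat_0_less_iff bot_nat_0.not_eq_extremum)
    define x where "x = (J + 1) / v"
    have x0: "x \<ge> 0" using v by (simp add: x_def)
    have Jx: "real J * x \<le> 1 / 2" using J v unfolding x_def v_def[symmetric] by (simp add: field_simps)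
    have step: "(1 - x) * p c \<le> p (Suc c)" if c: "real c \<le> n * q + J" for c
    proof -
      \<comment> \<open>Without the factor \<open>1 - x\<close>, the left side exceeds the right
        side by \<open>c + 1 - n q - q\<close>. This is negative while
        \<open>c + 1 \<le> n q\<close>, and otherwise at most \<open>J + 1\<close>, which is what
        subtracting \<open>x\<close> times at least \<open>v\<close> makes up for.\<close>
      have "(1 - x) * (real (Suc c) * (1 - q)) \<le> (real n - real c) * q"
      proof (cases "real c + 1 \<le> n * q")
        case True
        have "0 \<le> x * (real (Suc c) * (1 - q))" using x0 q by simp
        then show ?thesis using True q by (simp add: algebra_simps)
      next
        case False
        then have "n * q \<le> real (Suc c)" by simp
        then have "v \<le> real (Suc c) * (1 - q)" unfolding v_def using q by (intro mult_right_mono) auto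
        then have "x * v \<le> x * (real (Suc c) * (1 - q))" using x0 by (rule mult_left_mono)
        moreover have "x * v = J + 1" using v by (simp add: x_def)
        ultimately show ?thesis using c q by (simp add: algebra_simps)
      qed
      then have "(1 - x) * (real (Suc c) * (1 - q)) * p c \<le> (real n - real c) * q * p c"
        using p0 by (rule mult_right_mono)
      also have "\<dots> = real (Suc c) * (1 - q) * p (Suc c)" unfolding p_def by (rule Bernstein_step[symmetric])
      finally have "(real (Suc c) * (1 - q)) * ((1 - x) * p c) \<le> (real (Suc c) * (1 - q)) * p (Suc c)"
        by (simp only: mult_ac)
      then show ?thesis using q by (subst (asm) mult_le_cancel_left_pos) auto
    qed
    have ge: "(1 - real j * x) * p b \<le> p (b + j)" if "j \<le> J" for j
      using that
    proof (induction j)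
      case (Suc j)
      have "real j * x \<le> real J * x" using Suc x0 by (intro mult_right_mono) auto
      have "x \<le> 1"
      proof -
        have "1 * x \<le> real J * x" using False x0 by (intro mult_right_mono) auto
        then show ?thesis using Jx by simp
      qed
      have "(1 - real (Suc j) * x) \<le> (1 - x) * (1 - real j * x)" using x0 by (simp add: algebra_simps)
      then have "(1 - real (Suc j) * x) * p b \<le> (1 - x) * ((1 - real j * x) * p b)"
        using mult_right_mono[OF _ p0] by (metis mult.assoc)
      also have "\<dots> \<le> (1 - x) * p (b + j)" using Suc \<open>x \<le> 1\<close> by (intro mult_left_mono) auto
      also have "\<dots> \<le> p (Suc (b + j))" using Suc b by (intro step) auto
      finally show ?case by simp
    qed simp
    have "(real J + 1) * (p b / 2) = (\<Sum>j\<le>J. p b / 2)" by simp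
    also have "\<dots> \<le> (\<Sum>j\<le>J. p (b + j))"
    proof (rule sum_mono)
      fix j assume "j \<in> {..J}"
      then have "real j * x \<le> real J * x" using x0 by (intro mult_right_mono) auto
      then have "1 / 2 \<le> 1 - real j * x" using Jx by simp
      then have "1 / 2 * p b \<le> (1 - real j * x) * p b" using p0 by (rule mult_right_mono)
      then show "p b / 2 \<le> p (b + j)" using ge[of j] \<open>j \<in> {..J}\<close> by simp
    qed
    also have "\<dots> = (\<Sum>i\<in>(+) b ` {..J}. p i)" by (simp add: sum.reindex)
    also have "\<dots> \<le> (\<Sum>i\<le>n + b + J. p i)" by (rule sum_mono2) (use p0 in auto)
    also have "\<dots> = (\<Sum>i\<le>n. p i)" by (rule sum.mono_neutral_right) (auto simp: p_def Bernstein_gt)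
    also have "\<dots> = 1" by (simp add: p_def)
    finally show ?thesis by (simp add: p_def field_simps)
  qed
qed

text \<open>Above the mean, counting failures instead of successes leads back to the lower tail;
  \<open>q (1 - q)\<close> is unchanged by this.\<close>

lemma Bernstein_le:
  assumes q: "0 < q" "q < 1" and J: "2 * real J * (real J + 1) \<le> n * q * (1 - q)"
  shows "Bernstein n b q \<le> 2 / (real J + 1)"
proof (cases "real b \<le> n * q")
  case True
  then show ?thesis using Bernstein_lower_tail_le assms by simp
next
  case False
  show ?thesis
  proof (cases "b \<le> n")
    case True
    have "Bernstein n b q = Bernstein n (n - b) (1 - q)"
      using True by (simp add: Bernstein_def binomial_symmetric[OF True] mult_ac)
    also have "\<dots> \<le> 2 / (real J + 1)"
    proof (rule Bernstein_lower_tail_le)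
      show "2 * real J * (real J + 1) \<le> n * (1 - q) * (1 - (1 - q))" using J by (simp add: mult.commute mult.left_commute)
      show "real (n - b) \<le> n * (1 - q)" using False True by (simp add: of_nat_diff algebra_simps)
    qed (use q in auto)
    finally show ?thesis .
  qed (simp add: Bernstein_gt)
qed

lemma sum_Bernstein_centered_sq:
  "(\<Sum>j\<le>n. Bernstein n j q * (real j - n * q)\<^sup>2) = n * q * (1 - q)"
proof -
  have "(\<Sum>j\<le>n. Bernstein n j q * (real j - n * q)\<^sup>2) =
    (\<Sum>j\<le>n. real j * (real j - 1) * Bernstein n j q) + (1 - 2 * (n * q)) * (\<Sum>j\<le>n. real j * Bernstein n j q)
     + (n * q)\<^sup>2 * (\<Sum>j\<le>n. Bernstein n j q)"
    unfolding sum_distrib_left sum.distrib[symmetric]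
    by (rule sum.cong[OF refl]) (simp only: power2_eq_square, algebra)
  also have "\<dots> = n * q * (1 - q)"
    unfolding sum_kk_Bernstein sum_k_Bernstein sum_Bernstein by (simp add: power2_eq_square algebra_simps)
  finally show ?thesis .
qed

text \<open>Anti-concentration: fewer than \<open>2 L\<close> integers are closer than
  \<open>L\<close> to \<open>i\<close>, and none of them carries much weight.\<close>

lemma sum_Bernstein_near:
  assumes q: "0 < q" "q < 1" and J: "2 * real J * (real J + 1) \<le> n * q * (1 - q)"
  shows "(\<Sum>j\<le>n. Bernstein n j q * of_bool (\<bar>real i - real j\<bar> < real L)) \<le> (2 * real L) * (2 / (real J + 1))"
proof -
  let ?S = "{j. j \<le> n \<and> \<bar>real i - real j\<bar> < real L}"
  have sub: "?S \<subseteq> {i + 1 - L..<i + L}" by (auto simp: abs_less_iff)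
  have "card ?S \<le> card {i + 1 - L..<i + L}" using sub by (intro card_mono) auto
  then have "real (card ?S) \<le> 2 * real L" by simp
  have "(\<Sum>j\<le>n. Bernstein n j q * of_bool (\<bar>real i - real j\<bar> < real L)) = (\<Sum>j\<in>?S. Bernstein n j q)"
    by (rule sum.mono_neutral_cong_right) auto
  also have "\<dots> \<le> card ?S * (2 / (real J + 1))"
    by (rule sum_bounded_above) (use Bernstein_le[OF q J] in auto)
  also have "\<dots> \<le> (2 * real L) * (2 / (real J + 1))"
    using \<open>real (card ?S) \<le> 2 * real L\<close> by (intro mult_right_mono) auto
  finally show ?thesis .
qed

section \<open>Restricting stable matchings to a profile class\<close>

definition cls :: "nat \<Rightarrow> (nat \<Rightarrow> 'v) \<Rightarrow> 'v \<Rightarrow> nat set" where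
  "cls n a p = {i \<in> {..<n}. a i = p}"

abbreviation ties :: "nat \<Rightarrow> (nat \<Rightarrow> nat \<Rightarrow> nat) set" where
  "ties n \<equiv> {..<n} \<rightarrow>\<^sub>E rankings n"

abbreviation profs :: "nat \<Rightarrow> nat \<Rightarrow> (nat \<Rightarrow> bool list) set" where
  "profs n k \<equiv> {..<n} \<rightarrow>\<^sub>E Qk k"

lemma Qk: "finite (Qk k)" "card (Qk k) = 2 ^ k" "Qk k \<noteq> {}"
proof -
  have e: "Qk k = {xs. set xs \<subseteq> UNIV \<and> length xs = k}" by (auto simp: Qk_def)
  show "finite (Qk k)" unfolding e by (rule finite_lists_length_eq) simp
  show "card (Qk k) = 2 ^ k" unfolding e by (subst card_lists_length_eq) auto
  have "replicate k True \<in> Qk k" by (simp add: Qk_def)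
  then show "Qk k \<noteq> {}" by auto
qed

lemma rankings: "finite (rankings n)" "rankings n \<noteq> {}"
proof -
  show "finite (rankings n)"
    by (rule finite_subset[of _ "{..<n} \<rightarrow>\<^sub>E {..<n}"]) (auto simp: rankings_def intro!: finite_PiE)
  have "restrict id {..<n} \<in> rankings n" by (auto simp: rankings_def bij_betw_def inj_on_def)
  then show "rankings n \<noteq> {}" by auto
qed

lemma ties: "finite (ties n)" "ties n \<noteq> {}"
  using rankings by (auto simp: PiE_eq_empty_iff intro!: finite_PiE)

lemma profs: "finite (profs n k)" "profs n k \<noteq> {}"
  using Qk by (auto simp: PiE_eq_empty_iff intro!: finite_PiE)

lemma config_space: "finite (config_space n k)" "config_space n k \<noteq> {}"
  unfolding config_space_def using ties[of n] profs[of n k] by (simp_all del: PiE_eq_empty_iff)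

lemma prob_rpmp: "measure_pmf.prob (rpmp n k) {c. E c} = card {c \<in> config_space n k. E c} / card (config_space n k)"
  unfolding rpmp_def using measure_pmf_of_set[OF config_space(2,1)] by (simp add: Int_def conj_commute)

lemma ranking_inj: "f \<in> rankings n \<Longrightarrow> inj_on f {..<n}"
  by (auto simp: rankings_def bij_betw_def)

lemma ranking_transpose:
  assumes "f \<in> rankings n" "r < n" "s < n"
  shows "f \<circ> Transposition.transpose r s \<in> rankings n"
proof -
  have b: "bij_betw (Transposition.transpose r s) {..<n} {..<n}"
    using assms by (intro bij_betw_byWitness[of _ "Transposition.transpose r s"]) (auto simp: Transposition.transpose_def)
  have f: "bij_betw f {..<n} {..<n}" "f \<in> {..<n} \<rightarrow>\<^sub>E {..<n}" using assms by (auto simp: rankings_def)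
  have "bij_betw (f \<circ> Transposition.transpose r s) {..<n} {..<n}" by (rule bij_betw_trans[OF b f(1)])
  moreover have "f \<circ> Transposition.transpose r s \<in> {..<n} \<rightarrow>\<^sub>E {..<n}"
    using f(2) assms by (auto simp: PiE_def Pi_def extensional_def Transposition.transpose_def)
  ultimately show ?thesis by (simp add: rankings_def)
qed

lemma cls_fin: "finite (cls n a p)" by (simp add: cls_def)

lemma cls_lt: "i \<in> cls n a p \<Longrightarrow> i < n" by (simp add: cls_def)

lemma market_cls:
  assumes "Tm \<in> ties n" "Tw \<in> ties n"
  shows "market (cls n am p) (cls n aw q) Tm Tw"
proof
  fix x assume "x \<in> cls n am p"
  then have "Tm x \<in> rankings n" using assms by (auto simp: cls_def)
  then show "inj_on (Tm x) (cls n aw q)" by (rule inj_on_subset[OF ranking_inj]) (auto simp: cls_def)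
next
  fix x assume "x \<in> cls n aw q"
  then have "Tw x \<in> rankings n" using assms by (auto simp: cls_def)
  then show "inj_on (Tw x) (cls n am p)" by (rule inj_on_subset[OF ranking_inj]) (auto simp: cls_def)
qed (auto simp: cls_fin)

lemma blocking_converse:
  "blocking n d (am, aw, Tm, Tw) M m w \<longleftrightarrow> blocking n d (aw, am, Tw, Tm) (M\<inverse>) w m"
  by (auto simp: blocking_def man_prefers_def woman_prefers_def)

lemma stable_converse:
  "stable n d (am, aw, Tm, Tw) M \<longleftrightarrow> stable n d (aw, am, Tw, Tm) (M\<inverse>)"
proof -
  have "is_matching n M \<longleftrightarrow> is_matching n (M\<inverse>)" by (auto simp: is_matching_def)
  then show ?thesis unfolding stable_def using blocking_converse by blast
qed

lemma stable_partners_converse: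
  "stable_partners_man n d (am, aw, Tm, Tw) = stable_partners_woman n d (aw, am, Tw, Tm)"
  unfolding stable_partners_man_def stable_partners_woman_def
  by (intro ext Collect_cong) (metis converse_converse converse_iff stable_converse)

text \<open>This puts the own class at the top of every preference list, whatever the
  metric.\<close>

lemma metric_self_less:
  assumes "metric_on S d" "p \<in> S" "q \<in> S" "p \<noteq> q" shows "d p p < d p q" "d p p = 0"
  using assms unfolding metric_on_def by (metis order_le_less)+

lemma is_matchingD:
  assumes "is_matching n M"
  shows "M \<subseteq> {..<n} \<times> {..<n}" "(m, w) \<in> M \<Longrightarrow> (m, w') \<in> M \<Longrightarrow> w = w'"
    "(m, w) \<in> M \<Longrightarrow> (m', w) \<in> M \<Longrightarrow> m = m'"
proof -
  note a = assms[unfolded is_matching_def]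
  show "M \<subseteq> {..<n} \<times> {..<n}" by (rule conjunct1[OF a])
  show "(m, w) \<in> M \<Longrightarrow> (m, w') \<in> M \<Longrightarrow> w = w'" by (rule conjunct1[OF conjunct2[OF a], rule_format])
  show "(m, w) \<in> M \<Longrightarrow> (m', w) \<in> M \<Longrightarrow> m = m'" by (rule conjunct2[OF conjunct2[OF a], rule_format])
qed

lemma stableD:
  assumes "stable n d c M" shows "is_matching n M" "\<not> blocking n d c M m w"
  using assms unfolding stable_def by auto

text \<open>If a man \<open>x\<close> of the class had no partner in it, then by counting some woman
  \<open>y\<close> of the class would have none either. Both rank the class above everything
  outside, so they would block. Within the class all distances are equal and the tie breaks decide,
  which turns stability of \<open>M\<close> into stability for the ranks \<open>Tm\<close> and
  \<open>Tw\<close>.\<close>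

lemma stable_restrict:
  assumes met: "metric_on (Qk k) d" and am: "am \<in> profs n k" and aw: "aw \<in> profs n k"
    and T: "Tm \<in> ties n" "Tw \<in> ties n" and p: "p \<in> Qk k"
    and le: "card (cls n am p) \<le> card (cls n aw p)"
    and st: "stable n d (am, aw, Tm, Tw) M"
  shows "market.lstable (cls n am p) (cls n aw p) Tm Tw (M \<inter> cls n am p \<times> cls n aw p)"
proof -
  let ?X = "cls n am p" and ?Y = "cls n aw p"
  let ?L = "M \<inter> ?X \<times> ?Y"
  interpret market ?X ?Y Tm Tw by (rule market_cls[OF T])
  note M = is_matchingD[OF stableD(1)[OF st]] and nb = stableD(2)[OF st]
  have dm: "d p p < d p (am i)" if "i < n" "i \<notin> ?X" for i
    by (rule metric_self_less[OF met p]) (use that am in \<open>auto simp: cls_def\<close>)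
  have dw: "d p p < d p (aw i)" if "i < n" "i \<notin> ?Y" for i
    by (rule metric_self_less[OF met p]) (use that aw in \<open>auto simp: cls_def\<close>)
  have fL: "finite ?L" using cls_fin[of n am p] cls_fin[of n aw p] by simp
  have tot: "\<exists>y. (x, y) \<in> ?L" if x: "x \<in> ?X" for x
  proof (rule ccontr)
    assume n: "\<nexists>y. (x, y) \<in> ?L"
    have "card (snd ` ?L) \<le> card ?L" using fL by (rule card_image_le)
    also have "\<dots> = card (fst ` ?L)"
      by (rule card_image[symmetric]) (use M(2) in \<open>auto simp: inj_on_def\<close>)
    also have "\<dots> \<le> card (?X - {x})" using n cls_fin[of n am p] by (intro card_mono) auto
    also have "\<dots> < card ?X" by (rule card_Diff1_less[OF cls_fin x])
    finally have "card (snd ` ?L) < card ?Y" using le by simp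
    then obtain y where y: "y \<in> ?Y" "y \<notin> snd ` ?L"
      by (metis fL finite_imageI card_mono leD subsetI)
    have "blocking n d (am, aw, Tm, Tw) M x y"
      unfolding blocking_def
    proof (intro conjI allI impI)
      show "x < n" "y < n" using x y cls_lt by auto
      show "(x, y) \<notin> M" using n x y by auto
      show "man_prefers d (am, aw, Tm, Tw) x y w'" if "(x, w') \<in> M" for w'
      proof -
        have "w' < n" "w' \<notin> ?Y" using that n x M(1) by auto
        then show ?thesis using dw[of w'] x y by (simp add: man_prefers_def cls_def)
      qed
      show "woman_prefers d (am, aw, Tm, Tw) y x m'" if "(m', y) \<in> M" for m'
      proof -
        have "m' < n" "m' \<notin> ?X" using that y M(1) by force+
        then show ?thesis using dm[of m'] x y by (simp add: woman_prefers_def cls_def)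
      qed
    qed
    then show False using nb by blast
  qed
  have blk: "\<exists>x'. (x', y) \<in> ?L \<and> Tw y x' < Tw y x"
    if xy: "(x, y') \<in> ?L" and y: "y \<in> ?Y" and lt: "Tm x y < Tm x y'" for x y y'
  proof -
    have nM: "(x, y) \<notin> M" using M(2)[of x y y'] xy lt by auto
    have "\<not> blocking n d (am, aw, Tm, Tw) M x y" by (rule nb)
    moreover have "x < n" "y < n" using xy y cls_lt by auto
    moreover have "man_prefers d (am, aw, Tm, Tw) x y w'" if "(x, w') \<in> M" for w'
    proof -
      have "w' = y'" using M(2) that xy by blast
      then show ?thesis using xy y lt by (simp add: man_prefers_def cls_def)
    qed
    ultimately obtain m' where m': "(m', y) \<in> M" "\<not> woman_prefers d (am, aw, Tm, Tw) y x m'"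
      using nM unfolding blocking_def by blast
    have mn: "m' < n" using m' M(1) by auto
    have mX: "m' \<in> ?X"
    proof (rule ccontr)
      assume "m' \<notin> ?X"
      then show False using dm[OF mn] m'(2) xy y by (simp add: woman_prefers_def cls_def)
    qed
    then have "\<not> Tw y x < Tw y m'" using m'(2) xy y by (simp add: woman_prefers_def cls_def)
    moreover have "Tw y x \<noteq> Tw y m'" using injg[OF y] mX xy m'(1) nM by (auto simp: inj_on_def)
    ultimately show ?thesis using m'(1) mX y by (intro exI[of _ m']) auto
  qed
  show ?thesis
    unfolding lstable_def
  proof (intro conjI ballI allI impI)
    fix x assume "x \<in> ?X"
    then obtain y where y: "(x, y) \<in> ?L" using tot by blast
    show "\<exists>!y. (x, y) \<in> ?L"
    proof (rule ex1I)
      show "(x, y) \<in> ?L" by (rule y)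
      show "z = y" if "(x, z) \<in> ?L" for z using that M(2)[of x z y] y by blast
    qed
  next
    fix x x' y assume "(x, y) \<in> ?L" "(x', y) \<in> ?L"
    then show "x = x'" using M(3) by blast
  qed (use blk in blast)+
qed

lemma card_ge2_ex: "2 \<le> card S \<Longrightarrow> \<exists>x\<in>S. \<exists>y\<in>S. x \<noteq> y"
  by (metis card_le_Suc0_iff_eq card.infinite not_less_eq_eq numeral_2_eq_2 zero_le)

section \<open>Expected number of those with several stable partners, class by class\<close>

definition class_multi :: "nat \<Rightarrow> (bool list \<Rightarrow> bool list \<Rightarrow> real) \<Rightarrow> config \<Rightarrow> bool list \<Rightarrow> nat" where
  "class_multi n d c p = card {m \<in> cls n (fst c) p. 2 \<le> card (stable_partners_man n d c m)} +
     card {w \<in> cls n (fst (snd c)) p. 2 \<le> card (stable_partners_woman n d c w)}"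

lemma class_multi_converse: "class_multi n d (am, aw, Tm, Tw) p = class_multi n d (aw, am, Tw, Tm) p"
  unfolding class_multi_def stable_partners_converse[of n d am aw Tm Tw] stable_partners_converse[of n d aw am Tw Tm, symmetric] by simp

lemma card_cls_sum:
  assumes "a \<in> profs n k"
  shows "card {i \<in> {..<n}. E i} = (\<Sum>p\<in>Qk k. card {i \<in> cls n a p. E i})"
proof -
  have "(\<Sum>p\<in>Qk k. \<Sum>i\<in>{i \<in> {i \<in> {..<n}. E i}. a i = p}. 1) = (\<Sum>i\<in>{i \<in> {..<n}. E i}. (1::nat))"
    by (rule sum.group) (use assms Qk in auto)
  moreover have "{i \<in> {i \<in> {..<n}. E i}. a i = p} = {i \<in> cls n a p. E i}" for p
    by (auto simp: cls_def)
  ultimately show ?thesis by simp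
qed

lemma num_multi_class_multi:
  assumes "am \<in> profs n k" "aw \<in> profs n k"
  shows "num_multi n d (am, aw, Tm, Tw) = (\<Sum>p\<in>Qk k. class_multi n d (am, aw, Tm, Tw) p)"
  unfolding num_multi_def class_multi_def sum.distrib fst_conv snd_conv
  using card_cls_sum[OF assms(1), of "\<lambda>m. 2 \<le> card (stable_partners_man n d (am, aw, Tm, Tw) m)"]
    card_cls_sum[OF assms(2), of "\<lambda>w. 2 \<le> card (stable_partners_woman n d (am, aw, Tm, Tw) w)"]
  by (simp only:)

lemma class_multi_le:
  assumes met: "metric_on (Qk k) d" and am: "am \<in> profs n k" and aw: "aw \<in> profs n k"
    and T: "Tm \<in> ties n" "Tw \<in> ties n" and p: "p \<in> Qk k"
    and le: "card (cls n am p) \<le> card (cls n aw p)"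
  shows "class_multi n d (am, aw, Tm, Tw) p \<le> 2 * card (market.improvable (cls n am p) (cls n aw p) Tm Tw) + (card (cls n aw p) - card (cls n am p))"
proof -
  let ?X = "cls n am p" and ?Y = "cls n aw p" and ?c = "(am, aw, Tm, Tw)"
  interpret market ?X ?Y Tm Tw by (rule market_cls[OF T])
  note res = stable_restrict[OF met am aw T p le]
  have 1: "card {m \<in> ?X. 2 \<le> card (stable_partners_man n d ?c m)} \<le> card improvable"
  proof (rule card_multi_men[OF le])
    fix x assume x: "x \<in> {m \<in> ?X. 2 \<le> card (stable_partners_man n d ?c m)}"
    then obtain y1 y2 M1 M2 where y: "stable n d ?c M1" "(x, y1) \<in> M1" "stable n d ?c M2" "(x, y2) \<in> M2" "y1 \<noteq> y2"
      using card_ge2_ex unfolding stable_partners_man_def by fastforce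
    have "\<exists>z. (x, z) \<in> M1 \<inter> ?X \<times> ?Y" "\<exists>z. (x, z) \<in> M2 \<inter> ?X \<times> ?Y" using lstable_ex[OF res] y x by blast+
    moreover have "(x, z) \<in> M1 \<Longrightarrow> z = y1" "(x, z) \<in> M2 \<Longrightarrow> z = y2" for z
      using is_matchingD(2)[OF stableD(1)[OF y(1)] y(2)] is_matchingD(2)[OF stableD(1)[OF y(3)] y(4)] by blast+
    ultimately have "(x, y1) \<in> M1 \<inter> ?X \<times> ?Y" "(x, y2) \<in> M2 \<inter> ?X \<times> ?Y" by blast+
    then show "\<exists>L1 L2 y1 y2. lstable L1 \<and> lstable L2 \<and> (x, y1) \<in> L1 \<and> (x, y2) \<in> L2 \<and> y1 \<noteq> y2"
      using res y by blast
  qed auto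
  have 2: "card {w \<in> ?Y. 2 \<le> card (stable_partners_woman n d ?c w)} \<le> card improvable + (card ?Y - card ?X)"
  proof (rule card_multi_women[OF le])
    fix w assume w: "w \<in> {w \<in> ?Y. 2 \<le> card (stable_partners_woman n d ?c w)}" and reached: "w \<in> reached"
    then obtain x1 x2 M1 M2 where x: "stable n d ?c M1" "(x1, w) \<in> M1" "stable n d ?c M2" "(x2, w) \<in> M2" "x1 \<noteq> x2"
      using card_ge2_ex unfolding stable_partners_woman_def by fastforce
    have "\<exists>z. (z, w) \<in> M1 \<inter> ?X \<times> ?Y" "\<exists>z. (z, w) \<in> M2 \<inter> ?X \<times> ?Y" using reached_matched[OF res reached] x by blast+
    moreover have "(z, w) \<in> M1 \<Longrightarrow> z = x1" "(z, w) \<in> M2 \<Longrightarrow> z = x2" for z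
      using is_matchingD(3)[OF stableD(1)[OF x(1)] x(2)] is_matchingD(3)[OF stableD(1)[OF x(3)] x(4)] by blast+
    ultimately have "(x1, w) \<in> M1 \<inter> ?X \<times> ?Y" "(x2, w) \<in> M2 \<inter> ?X \<times> ?Y" by blast+
    then show "\<exists>L1 L2 x1 x2. lstable L1 \<and> lstable L2 \<and> (x1, w) \<in> L1 \<and> (x2, w) \<in> L2 \<and> x1 \<noteq> x2"
      using res x by blast
  qed auto
  show ?thesis unfolding class_multi_def using 1 2 by simp
qed

text \<open>The size of the larger class is replaced by the sum of both, which makes the bound
  symmetric in the two sexes and its expectation easy to split.\<close>

definition cost :: "nat \<Rightarrow> nat \<Rightarrow> real" where
  "cost i j = \<bar>real i - real j\<bar> + 2 * (real i + real j) / (\<bar>real i - real j\<bar> + 1)"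

lemma cost_commute: "cost i j = cost j i"
  by (simp add: cost_def abs_minus_commute add.commute)

text \<open>Only the proposers' lists are averaged, for any fixed lists of the other side; each
  \<open>y\<close> is improvable for a fraction of at most \<open>1 / (D + 1)\<close> of
  them.\<close>

lemma avg_class_multi_le:
  assumes met: "metric_on (Qk k) d" and am: "am \<in> profs n k" and aw: "aw \<in> profs n k"
    and Tw: "Tw \<in> ties n" and p: "p \<in> Qk k"
    and le: "card (cls n am p) \<le> card (cls n aw p)"
  shows "avg (ties n) (\<lambda>Tm. real (class_multi n d (am, aw, Tm, Tw) p)) \<le> cost (card (cls n am p)) (card (cls n aw p))"
proof -
  let ?X = "cls n am p" and ?Y = "cls n aw p"
  let ?D = "card ?Y - card ?X"
  have improvable: "market.improvable ?X ?Y Tm Tw \<subseteq> ?Y" if "Tm \<in> ties n" for Tm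
    using market.reached_sub[OF market_cls[OF that Tw], of am p aw p] unfolding market.improvable_def[OF market_cls[OF that Tw]] by blast
  have pt: "real (class_multi n d (am, aw, Tm, Tw) p) \<le> 2 * (\<Sum>y\<in>?Y. (of_bool (y \<in> market.improvable ?X ?Y Tm Tw) :: real)) + real ?D" if "Tm \<in> ties n" for Tm
  proof -
    have "(\<Sum>y\<in>?Y. (of_bool (y \<in> market.improvable ?X ?Y Tm Tw) :: real)) = real (card (market.improvable ?X ?Y Tm Tw))"
      using improvable[OF that] cls_fin[of n aw p] by (simp add: Int_absorb1 Int_commute)
    then show ?thesis using class_multi_le[OF met am aw that Tw p le] by linarith
  qed
  have y: "avg (ties n) (\<lambda>Tm. of_bool (y \<in> market.improvable ?X ?Y Tm Tw)) \<le> 1 / (real ?D + 1)" if yY: "y \<in> ?Y" for y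
  proof -
    have "(?D + 1) * card {Tm \<in> ties n. y \<in> market.improvable ?X ?Y Tm Tw} \<le> card (ties n)"
    proof (rule card_improvable_le[OF _ ties(1) le yY])
      show "market ?X ?Y Tm Tw" if "Tm \<in> ties n" for Tm by (rule market_cls[OF that Tw])
      fix Tm S u assume a: "Tm \<in> ties n" "S \<subseteq> ?X" "u \<in> ?Y"
      have "Tm x \<circ> Transposition.transpose y u \<in> rankings n" if "x < n" for x
        using that a yY cls_lt by (intro ranking_transpose) auto
      then show "(\<lambda>x. if x \<in> S then Tm x \<circ> Transposition.transpose y u else Tm x) \<in> ties n"
        using a(1) subsetD[OF a(2)] cls_lt[of _ n am p] by (fastforce simp: PiE_def Pi_def extensional_def)
    qed
    then have "real (?D + 1) * real (card {Tm \<in> ties n. y \<in> market.improvable ?X ?Y Tm Tw}) \<le> real (card (ties n))"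
      by (simp only: of_nat_mult[symmetric] of_nat_le_iff)
    moreover have "real (card (ties n)) > 0" using ties[of n] by (simp only: of_nat_0_less_iff card_gt_0_iff) blast
    ultimately show ?thesis unfolding avg_indicator[OF ties(1)] by (simp add: field_simps)
  qed
  have "avg (ties n) (\<lambda>Tm. real (class_multi n d (am, aw, Tm, Tw) p))
     \<le> avg (ties n) (\<lambda>Tm. 2 * (\<Sum>y\<in>?Y. (of_bool (y \<in> market.improvable ?X ?Y Tm Tw) :: real)) + real ?D)"
    by (rule avg_mono[OF pt])
  also have "\<dots> = 2 * (\<Sum>y\<in>?Y. avg (ties n) (\<lambda>Tm. (of_bool (y \<in> market.improvable ?X ?Y Tm Tw) :: real))) + real ?D"
    unfolding avg_add avg_cmult avg_sum avg_const[OF ties] ..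
  also have "\<dots> \<le> 2 * (\<Sum>y\<in>?Y. 1 / (real ?D + 1)) + real ?D"
    using y by (intro add_mono mult_left_mono sum_mono) auto
  also have "\<dots> = real ?D + 2 * (card ?Y / (real ?D + 1))" by simp
  also have "\<dots> \<le> real ?D + 2 * ((real (card ?X) + real (card ?Y)) / (real ?D + 1))"
    by (intro add_mono mult_left_mono divide_right_mono) auto
  also have "\<dots> = cost (card ?X) (card ?Y)"
    using le by (simp add: cost_def of_nat_diff abs_if)
  finally show ?thesis .
qed

lemma avg_num_multi_ties:
  assumes met: "metric_on (Qk k) d" and am: "am \<in> profs n k" and aw: "aw \<in> profs n k"
  shows "avg (ties n \<times> ties n) (\<lambda>(Tm, Tw). real (num_multi n d (am, aw, Tm, Tw)))
     \<le> (\<Sum>p\<in>Qk k. cost (card (cls n am p)) (card (cls n aw p)))"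
proof -
  have "avg (ties n \<times> ties n) (\<lambda>(Tm, Tw). real (num_multi n d (am, aw, Tm, Tw)))
    = (\<Sum>p\<in>Qk k. avg (ties n \<times> ties n) (\<lambda>(Tm, Tw). real (class_multi n d (am, aw, Tm, Tw) p)))"
    unfolding avg_sum[symmetric] case_prod_beta' num_multi_class_multi[OF am aw] of_nat_sum ..
  also have "\<dots> \<le> (\<Sum>p\<in>Qk k. cost (card (cls n am p)) (card (cls n aw p)))"
  proof (rule sum_mono)
    fix p assume p: "p \<in> Qk k"
    show "avg (ties n \<times> ties n) (\<lambda>(Tm, Tw). real (class_multi n d (am, aw, Tm, Tw) p)) \<le> cost (card (cls n am p)) (card (cls n aw p))"
    proof (cases "card (cls n am p) \<le> card (cls n aw p)")
      case True
      show ?thesis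
        unfolding avg_Times prod.case
        by (subst avg_swap, rule avg_le_const[OF ties], rule avg_class_multi_le[OF met am aw _ p True])
    next
      case False
      \<comment> \<open>With more men than women the women propose, and the average is taken over
        their lists instead.\<close>
      show ?thesis
        unfolding avg_Times prod.case class_multi_converse[of n d am] cost_commute[of "card (cls n am p)"]
        by (rule avg_le_const[OF ties], rule avg_class_multi_le[OF met aw am _ p]) (use False in auto)
    qed
  qed
  finally show ?thesis .
qed

lemma avg_num_multi:
  assumes met: "metric_on (Qk k) d"
  shows "avg (config_space n k) (\<lambda>c. real (num_multi n d c))
     \<le> 2 ^ k * (\<Sum>i\<le>n. Bernstein n i (1 / 2 ^ k) * (\<Sum>j\<le>n. Bernstein n j (1 / 2 ^ k) * cost i j))"
proof -
  have "avg (config_space n k) (\<lambda>c. real (num_multi n d c)) =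
    avg (profs n k) (\<lambda>am. avg (profs n k) (\<lambda>aw. avg (ties n \<times> ties n) (\<lambda>(Tm, Tw). real (num_multi n d (am, aw, Tm, Tw)))))"
    unfolding config_space_def by (simp only: avg_Times prod.case)
  also have "\<dots> \<le> avg (profs n k) (\<lambda>am. avg (profs n k) (\<lambda>aw. \<Sum>p\<in>Qk k. cost (card (cls n am p)) (card (cls n aw p))))"
    by (intro avg_mono avg_num_multi_ties[OF met])
  also have "\<dots> = (\<Sum>p\<in>Qk k. avg (profs n k) (\<lambda>am. avg (profs n k) (\<lambda>aw. cost (card (cls n am p)) (card (cls n aw p)))))"
    by (simp only: avg_sum)
  also have "\<dots> = (\<Sum>p\<in>Qk k. (\<Sum>i\<le>n. Bernstein n i (1 / 2 ^ k) * (\<Sum>j\<le>n. Bernstein n j (1 / 2 ^ k) * cost i j)))"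
  proof (rule sum.cong[OF refl])
    fix p assume p: "p \<in> Qk k"
    have q: "1 / real (card (Qk k)) = 1 / 2 ^ k" by (simp add: Qk)
    show "avg (profs n k) (\<lambda>am. avg (profs n k) (\<lambda>aw. cost (card (cls n am p)) (card (cls n aw p))))
      = (\<Sum>i\<le>n. Bernstein n i (1 / 2 ^ k) * (\<Sum>j\<le>n. Bernstein n j (1 / 2 ^ k) * cost i j))"
      unfolding cls_def avg_count[OF Qk(1) p, unfolded q] 
        avg_count[OF Qk(1) p, unfolded q, of n "\<lambda>i. \<Sum>j\<le>n. Bernstein n j (1 / 2 ^ k) * cost i j"] ..
  qed
  also have "\<dots> = 2 ^ k * (\<Sum>i\<le>n. Bernstein n i (1 / 2 ^ k) * (\<Sum>j\<le>n. Bernstein n j (1 / 2 ^ k) * cost i j))"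
    by (simp add: Qk)
  finally show ?thesis .
qed

section \<open>Few profiles\<close>

text \<open>The expectation of \<open>F\<close> at the numbers of men and women in one class, which
  are independent and binomial.\<close>

definition bexp :: "nat \<Rightarrow> real \<Rightarrow> (nat \<Rightarrow> nat \<Rightarrow> real) \<Rightarrow> real" where
  "bexp n q F = (\<Sum>i\<le>n. Bernstein n i q * (\<Sum>j\<le>n. Bernstein n j q * F i j))"

lemma bexp_alt: "bexp n q F = (\<Sum>i\<le>n. \<Sum>j\<le>n. Bernstein n i q * Bernstein n j q * F i j)"
  by (simp add: bexp_def sum_distrib_left mult.assoc)

lemma bexp_mono:
  assumes "0 \<le> q" "q \<le> 1" "\<And>i j. F i j \<le> G i j" shows "bexp n q F \<le> bexp n q G"
  unfolding bexp_def using assms by (intro sum_mono mult_left_mono) (auto simp: Bernstein_nonneg)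

lemma bexp_add: "bexp n q (\<lambda>i j. F i j + G i j) = bexp n q F + bexp n q G"
  by (simp add: bexp_def distrib_left sum.distrib)

lemma bexp_cmult: "bexp n q (\<lambda>i j. c * F i j) = c * bexp n q F"
  by (simp add: bexp_alt sum_distrib_left mult_ac)

lemma bexp_flip: "bexp n q (\<lambda>i j. F j i) = bexp n q F"
  unfolding bexp_alt by (subst sum.swap) (simp add: mult_ac)

lemma bexp_fst: "bexp n q (\<lambda>i j. F i) = (\<Sum>i\<le>n. Bernstein n i q * F i)"
  by (simp add: bexp_def sum_distrib_right[symmetric])

lemma bexp_snd: "bexp n q (\<lambda>i j. F j) = (\<Sum>i\<le>n. Bernstein n i q * F i)"
  using bexp_flip[of n q "\<lambda>i j. F i"] bexp_fst by simp

lemma bexp_const: "bexp n q (\<lambda>i j. c) = c"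
  by (simp add: bexp_def sum_distrib_right[symmetric])

text \<open>The absolute difference is traded for squared deviations from \<open>m\<close> by the
  arithmetic-geometric mean inequality with parameter \<open>t\<close>. In the quotient, differences
  of at least \<open>L\<close> gain the factor \<open>1 / L\<close>, and smaller ones are left to
  anti-concentration.\<close>

lemma cost_le:
  assumes t: "0 < t" and L: "1 \<le> L"
  shows "cost i j \<le> (1 / t) * ((real i - m)\<^sup>2 + (real j - m)\<^sup>2) + t / 2
     + (2 / real L) * (real i + real j)
     + 2 * (real i * of_bool (\<bar>real i - real j\<bar> < real L) + real j * of_bool (\<bar>real i - real j\<bar> < real L))"
proof -
  define D where "D = \<bar>real i - real j\<bar>"
  have D0: "D \<ge> 0" by (simp add: D_def)
  have "D\<^sup>2 = ((real i - m) - (real j - m))\<^sup>2" by (simp add: D_def)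
  also have "\<dots> \<le> 2 * ((real i - m)\<^sup>2 + (real j - m)\<^sup>2)"
    using zero_le_power2[of "(real i - m) + (real j - m)"] by (simp add: power2_eq_square algebra_simps)
  finally have sq: "D\<^sup>2 \<le> 2 * ((real i - m)\<^sup>2 + (real j - m)\<^sup>2)" .
  have "2 * D * t \<le> D\<^sup>2 + t\<^sup>2" by (rule sum_squares_bound)
  then have "2 * D * t \<le> 2 * ((real i - m)\<^sup>2 + (real j - m)\<^sup>2) + t\<^sup>2" using sq by linarith
  then have "D \<le> (1 / t) * ((real i - m)\<^sup>2 + (real j - m)\<^sup>2) + t / 2"
    using t by (simp add: field_simps power2_eq_square)
  moreover have "2 * (real i + real j) / (D + 1) \<le> (2 / real L) * (real i + real j)
     + 2 * (real i * of_bool (D < real L) + real j * of_bool (D < real L))"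
  proof (cases "D < real L")
    case True
    have "2 * (real i + real j) / (D + 1) \<le> 2 * (real i + real j) / 1"
      using D0 by (intro divide_left_mono) auto
    also have "\<dots> \<le> (2 / real L) * (real i + real j) + 2 * (real i + real j) / 1"
      by (rule add_increasing) auto
    finally show ?thesis using True by (simp only: of_bool_eq if_True simp_thms mult_1_right div_by_1)
  next
    case False
    have "2 * (real i + real j) / (D + 1) \<le> 2 * (real i + real j) / real L"
      using False L by (intro divide_left_mono) auto
    then show ?thesis using False by simp
  qed
  ultimately show ?thesis unfolding cost_def D_def by linarith
qed

lemma bexp_cost_le:
  assumes q: "0 < q" "q < 1" and s: "s = n * q" "s > 0"
    and J: "2 * real J * (real J + 1) \<le> n * q * (1 - q)" and L: "1 \<le> L"
  shows "bexp n q cost \<le> 5 / 2 * sqrt s + 4 * s / real L + 16 * s * real L / (real J + 1)"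
proof -
  \<comment> \<open>Both variances are at most \<open>s\<close>, so this choice turns
    \<open>2 s / t + t / 2\<close> into \<open>5 / 2 * sqrt s\<close>.\<close>
  define t where "t = sqrt s"
  have t: "t > 0" "t * t = s" using s by (auto simp: t_def)
  let ?ob = "\<lambda>i j. of_bool (\<bar>real i - real j\<bar> < real L) :: real"
  have mean: "(\<Sum>i\<le>n. Bernstein n i q * real i) = s" using sum_k_Bernstein[of n q] s by (simp add: mult.commute)
  have "(\<Sum>i\<le>n. Bernstein n i q * (real i - s)\<^sup>2) = s * (1 - q)" using sum_Bernstein_centered_sq[of n q] s by simp
  also have "\<dots> \<le> s" using q s by (intro mult_left_le) auto
  finally have var: "(\<Sum>i\<le>n. Bernstein n i q * (real i - s)\<^sup>2) \<le> s" .
  have "bexp n q (\<lambda>i j. real i * ?ob i j) = (\<Sum>i\<le>n. (Bernstein n i q * real i) * (\<Sum>j\<le>n. Bernstein n j q * ?ob i j))"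
    by (simp only: bexp_def sum_distrib_left mult_ac)
  also have "\<dots> \<le> (\<Sum>i\<le>n. (Bernstein n i q * real i) * ((2 * real L) * (2 / (real J + 1))))"
    by (intro sum_mono mult_left_mono sum_Bernstein_near[OF q J]) (use q in \<open>auto simp: Bernstein_nonneg\<close>)
  also have "\<dots> = s * ((2 * real L) * (2 / (real J + 1)))"
    unfolding sum_distrib_right[symmetric] mean ..
  finally have near: "bexp n q (\<lambda>i j. real i * ?ob i j) \<le> s * ((2 * real L) * (2 / (real J + 1)))" .
  have flip: "bexp n q (\<lambda>i j. real j * ?ob i j) = bexp n q (\<lambda>i j. real i * ?ob i j)"
    using bexp_flip[of n q "\<lambda>i j. real i * ?ob i j"] by (simp add: abs_minus_commute)
  have "bexp n q cost \<le> bexp n q (\<lambda>i j. (1 / t) * ((real i - s)\<^sup>2 + (real j - s)\<^sup>2) + t / 2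
     + (2 / real L) * (real i + real j) + 2 * (real i * ?ob i j + real j * ?ob i j))"
    by (rule bexp_mono) (use q cost_le[OF t(1) L] in auto)
  also have "\<dots> = (1 / t) * ((\<Sum>i\<le>n. Bernstein n i q * (real i - s)\<^sup>2) + (\<Sum>i\<le>n. Bernstein n i q * (real i - s)\<^sup>2))
     + t / 2 + (2 / real L) * (s + s) + 2 * (bexp n q (\<lambda>i j. real i * ?ob i j) + bexp n q (\<lambda>i j. real i * ?ob i j))"
    unfolding bexp_add bexp_cmult bexp_const flip bexp_fst bexp_snd mean ..
  also have "\<dots> \<le> (1 / t) * (s + s) + t / 2 + (2 / real L) * (s + s)
     + 2 * (s * ((2 * real L) * (2 / (real J + 1))) + s * ((2 * real L) * (2 / (real J + 1))))"
    using near var t by (intro add_mono mult_left_mono order_refl) auto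
  also have "(1 / t) * (s + s) = 2 * t" using t by (simp add: field_simps)
  finally have "bexp n q cost \<le> 2 * t + t / 2 + (2 / real L) * (s + s)
     + 2 * (s * ((2 * real L) * (2 / (real J + 1))) + s * ((2 * real L) * (2 / (real J + 1))))" .
  also have "\<dots> = 5 / 2 * t + 4 * s / real L + 16 * s * real L / (real J + 1)"
    unfolding divide_inverse by (simp add: algebra_simps)
  finally show ?thesis by (simp only: t_def)
qed

lemma avg_num_multi_small:
  assumes "\<eta> > 0"
  obtains s0 where "\<And>n k d. 1 \<le> k \<Longrightarrow> metric_on (Qk k) d \<Longrightarrow> s0 \<le> real n / 2 ^ k \<Longrightarrow>
    avg (config_space n k) (\<lambda>c. real (num_multi n d c)) \<le> \<eta> * (2 * real n)"
proof -
  \<comment> \<open>Each of the three terms of \<open>bexp_cost_le\<close> is to be at most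
    \<open>2 * \<eta> / 3 * s\<close>. This asks for \<open>L\<close> of size
    \<open>6 / \<eta>\<close>, then \<open>J\<close> of size \<open>24 L / \<eta>\<close>, then
    \<open>sqrt s\<close> at least \<open>15 / (4 \<eta>)\<close>. The bound
    \<open>4 J (J + 1)\<close> on \<open>s\<close> suffices because \<open>1 \<le> k\<close> gives
    \<open>1 - q \<ge> 1 / 2\<close>. The result depends on \<open>\<eta>\<close> alone.\<close>
  define L where "L = nat \<lceil>6 / \<eta>\<rceil> + 1"
  have L: "1 \<le> L" "6 / \<eta> \<le> real L" by (auto simp: L_def) linarith
  define J where "J = nat \<lceil>24 * real L / \<eta>\<rceil>"
  have J: "24 * real L / \<eta> \<le> real J + 1" unfolding J_def by linarith
  define s0 where "s0 = max ((15 / (4 * \<eta>))\<^sup>2) (4 * real J * (real J + 1)) + 1"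
  have s0: "(15 / (4 * \<eta>))\<^sup>2 \<le> s0" "4 * real J * (real J + 1) \<le> s0" "0 < s0"
    unfolding s0_def by (auto simp: max_def intro: add_nonneg_pos)
  show ?thesis
  proof (rule that[of s0])
    fix n k d
    assume k: "(1::nat) \<le> k" and met: "metric_on (Qk k) d" and le: "s0 \<le> real n / 2 ^ k"
    define q :: real where "q = 1 / 2 ^ k"
    define s where "s = real n * q"
    have s: "s0 \<le> s" "s > 0" using le s0 by (auto simp: s_def q_def)
    have "(2::real) ^ 1 \<le> 2 ^ k" using k by (intro power_increasing) auto
    then have q: "0 < q" "q \<le> 1 / 2" "q < 1" by (auto simp: q_def field_simps)
    have "2 * real J * (real J + 1) \<le> s / 2" using s0 s by simp
    also have "\<dots> \<le> n * q * (1 - q)" using q s unfolding s_def[symmetric] by (simp add: field_simps)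
    finally have "bexp n q cost \<le> 5 / 2 * sqrt s + 4 * s / real L + 16 * s * real L / (real J + 1)"
      using bexp_cost_le[OF q(1,3) s_def s(2) _ L(1)] by blast
    also have "\<dots> \<le> 2 * \<eta> / 3 * s + 2 * \<eta> / 3 * s + 2 * \<eta> / 3 * s"
    proof (intro add_mono)
      have "15 / (4 * \<eta>) \<le> sqrt s" using s0 s assms by (intro real_le_rsqrt) auto
      then have "15 / (4 * \<eta>) * sqrt s \<le> sqrt s * sqrt s" using s by (intro mult_right_mono) auto
      then show "5 / 2 * sqrt s \<le> 2 * \<eta> / 3 * s" using assms s by (simp add: field_simps)
      have "4 / real L \<le> 2 * \<eta> / 3" using L assms by (simp add: field_simps)
      then have "4 / real L * s \<le> 2 * \<eta> / 3 * s" using s by (intro mult_right_mono) auto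
      then show "4 * s / real L \<le> 2 * \<eta> / 3 * s" by simp
      have "16 * real L / (real J + 1) \<le> 2 * \<eta> / 3" using J assms by (simp add: field_simps)
      then have "16 * real L / (real J + 1) * s \<le> 2 * \<eta> / 3 * s" using s by (intro mult_right_mono) auto
      then show "16 * s * real L / (real J + 1) \<le> 2 * \<eta> / 3 * s" by (simp add: mult_ac)
    qed
    finally have b: "bexp n q cost \<le> 2 * \<eta> * s" by (simp add: field_simps)
    have "avg (config_space n k) (\<lambda>c. real (num_multi n d c)) \<le> 2 ^ k * bexp n q cost"
      using avg_num_multi[OF met] by (simp add: bexp_def q_def)
    also have "\<dots> \<le> 2 ^ k * (2 * \<eta> * s)" using b by (intro mult_left_mono) auto
    also have "\<dots> = \<eta> * (2 * real n)" by (simp add: s_def q_def)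
    finally show "avg (config_space n k) (\<lambda>c. real (num_multi n d c)) \<le> \<eta> * (2 * real n)" .
  qed
qed

lemma multi_fraction_tendsto_0:
  fixes k :: "nat \<Rightarrow> nat" and d :: "nat \<Rightarrow> bool list \<Rightarrow> bool list \<Rightarrow> real"
  assumes eps: "\<epsilon> > 0" and k_pos: "\<And>n. k n \<ge> 1" and metric: "\<And>n. metric_on (Qk (k n)) (d n)"
    and small: "\<forall>\<^sub>F n in sequentially. real (k n) < (1 - \<epsilon>) * log 2 (real n)" and \<delta>: "\<delta> > 0"
  shows "(\<lambda>n. measure_pmf.prob (rpmp n (k n)) {c. real (num_multi n (d n) c) / (2 * real n) > \<delta>}) \<longlonglongrightarrow> 0"
proof -
  have "filterlim (\<lambda>n. exp (\<epsilon> * ln (real n))) at_top sequentially"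
    by (intro filterlim_compose[OF exp_at_top] filterlim_tendsto_pos_mult_at_top[OF tendsto_const eps]
        filterlim_compose[OF ln_at_top] filterlim_real_sequentially)
  \<comment> \<open>The exponential is the power of \<open>n\<close> with exponent
    \<open>\<epsilon>\<close>, so the mean class size tends to infinity.\<close>
  moreover have "\<forall>\<^sub>F n in sequentially. exp (\<epsilon> * ln (real n)) \<le> real n / 2 ^ k n"
    using small eventually_gt_at_top[of 0]
  proof eventually_elim
    case (elim n)
    have "(2::real) ^ k n = 2 powr real (k n)" by (simp add: powr_realpow)
    also have "\<dots> \<le> 2 powr (log 2 (real n) * (1 - \<epsilon>))" using elim by (intro powr_mono) (auto simp: mult.commute)
    also have "\<dots> = real n powr (1 - \<epsilon>)" using elim by (simp add: powr_powr[symmetric])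
    finally have "2 ^ k n * real n powr \<epsilon> \<le> real n powr (1 - \<epsilon>) * real n powr \<epsilon>" by (intro mult_right_mono) auto
    also have "\<dots> = real n" using elim by (simp add: powr_add[symmetric])
    finally have "real n powr \<epsilon> \<le> real n / 2 ^ k n" by (simp add: field_simps)
    then show ?case using elim by (simp add: powr_def)
  qed
  ultimately have s: "filterlim (\<lambda>n. real n / 2 ^ k n) at_top sequentially"
    by (rule filterlim_at_top_mono)
  show ?thesis
  proof (rule tendstoI)
    fix e :: real assume e: "e > 0"
    obtain s0 where s0: "\<And>n k d. 1 \<le> k \<Longrightarrow> metric_on (Qk k) d \<Longrightarrow> s0 \<le> real n / 2 ^ k \<Longrightarrow>
      avg (config_space n k) (\<lambda>c. real (num_multi n d c)) \<le> (\<delta> * e / 2) * (2 * real n)"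
      using avg_num_multi_small[of "\<delta> * e / 2"] \<delta> e by (metis divide_pos_pos mult_pos_pos zero_less_numeral)
    have "\<forall>\<^sub>F n in sequentially. s0 \<le> real n / 2 ^ k n" using s by (simp add: filterlim_at_top)
    then show "\<forall>\<^sub>F n in sequentially. dist (measure_pmf.prob (rpmp n (k n)) {c. real (num_multi n (d n) c) / (2 * real n) > \<delta>}) 0 < e"
      using eventually_gt_at_top[of 0]
    proof eventually_elim
      case (elim n)
      have "measure_pmf.prob (rpmp n (k n)) {c. real (num_multi n (d n) c) / (2 * real n) > \<delta>}
         \<le> avg (config_space n (k n)) (\<lambda>c. real (num_multi n (d n) c) / (2 * real n)) / \<delta>"
        unfolding prob_rpmp by (rule markov[OF config_space(1)]) (use \<delta> in auto)
      also have "avg (config_space n (k n)) (\<lambda>c. real (num_multi n (d n) c) / (2 * real n))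
         = (1 / (2 * real n)) * avg (config_space n (k n)) (\<lambda>c. real (num_multi n (d n) c))"
        unfolding avg_cmult[symmetric] by simp
      also have "\<dots> \<le> (1 / (2 * real n)) * ((\<delta> * e / 2) * (2 * real n))"
        using s0[OF k_pos metric elim(1)] by (intro mult_left_mono) auto
      also have "\<dots> = \<delta> * e / 2" using elim by simp
      finally have "measure_pmf.prob (rpmp n (k n)) {c. real (num_multi n (d n) c) / (2 * real n) > \<delta>} \<le> e / 2"
        using \<delta> by (simp add: field_simps divide_right_mono)
      then show ?case using e by simp
    qed
  qed
qed

section \<open>Profiles with two men and two women\<close>

lemma card_less_iff_strict_order:
  assumes "finite S" and irr: "\<And>x. \<not> lt x x"
    and tr: "\<And>x y z. lt x y \<Longrightarrow> lt y z \<Longrightarrow> lt x z"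
    and tot: "\<And>x y. x \<in> S \<Longrightarrow> y \<in> S \<Longrightarrow> x \<noteq> y \<Longrightarrow> lt x y \<or> lt y x"
    and x: "x \<in> S" and y: "y \<in> S"
  shows "card {z \<in> S. lt z x} < card {z \<in> S. lt z y} \<longleftrightarrow> lt x y"
proof -
  have less: "card {z \<in> S. lt z x} < card {z \<in> S. lt z y}" if "lt x y" "x \<in> S" for x y
  proof (rule psubset_card_mono)
    have "{z \<in> S. lt z x} \<subseteq> {z \<in> S. lt z y}" using tr[OF _ that(1)] by auto
    moreover have "x \<in> {z \<in> S. lt z y}" "x \<notin> {z \<in> S. lt z x}" using that irr by auto
    ultimately show "{z \<in> S. lt z x} \<subset> {z \<in> S. lt z y}" by (metis psubsetI)
  qed (use assms(1) in simp)
  show ?thesis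
  proof
    assume a: "card {z \<in> S. lt z x} < card {z \<in> S. lt z y}"
    then have "x \<noteq> y" by auto
    moreover have "\<not> lt y x" using less[of y x] y a by auto
    ultimately show "lt x y" using tot x y by blast
  qed (use less x in blast)
qed

lemma man_prefers_order:
  shows "\<not> man_prefers d c m w w"
    "man_prefers d c m w1 w2 \<Longrightarrow> man_prefers d c m w2 w3 \<Longrightarrow> man_prefers d c m w1 w3"
  by (cases c; auto simp: man_prefers_def)+

lemma woman_prefers_conv: "woman_prefers d (am, aw, Tm, Tw) = man_prefers d (aw, am, Tw, Tm)"
  by (intro ext) (simp add: man_prefers_def woman_prefers_def)

lemma man_prefers_total:
  assumes "Tm \<in> ties n" "m < n" "w1 < n" "w2 < n" "w1 \<noteq> w2"
  shows "man_prefers d (am, aw, Tm, Tw) m w1 w2 \<or> man_prefers d (am, aw, Tm, Tw) m w2 w1"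
proof -
  have "Tm m \<in> rankings n" using assms by auto
  then have "Tm m w1 \<noteq> Tm m w2" using ranking_inj assms by (auto simp: inj_on_def)
  then show ?thesis unfolding man_prefers_def by auto
qed

text \<open>Counting the preferred members turns a preference into a numerical rank, so the whole
  population becomes a market with both sides of size \<open>n\<close>, and its proposer-optimal
  outcome is stable.\<close>

lemma stable_exists:
  assumes T: "Tm \<in> ties n" "Tw \<in> ties n"
  shows "\<exists>M. stable n d (am, aw, Tm, Tw) M"
proof -
  let ?c = "(am, aw, Tm, Tw)" and ?c' = "(aw, am, Tw, Tm)"
  define f where "f = (\<lambda>m w. card {w' \<in> {..<n}. man_prefers d ?c m w' w})"
  define g where "g = (\<lambda>w m. card {m' \<in> {..<n}. woman_prefers d ?c w m' m})"
  have f: "f m w < f m w' \<longleftrightarrow> man_prefers d ?c m w w'" if "m < n" "w < n" "w' < n" for m w w'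
    unfolding f_def
  proof (rule card_less_iff_strict_order[OF finite_lessThan])
    show "\<not> man_prefers d ?c m x x" for x by (rule man_prefers_order)
    show "man_prefers d ?c m x y \<Longrightarrow> man_prefers d ?c m y z \<Longrightarrow> man_prefers d ?c m x z" for x y z
      by (rule man_prefers_order)
    show "x \<in> {..<n} \<Longrightarrow> y \<in> {..<n} \<Longrightarrow> x \<noteq> y \<Longrightarrow> man_prefers d ?c m x y \<or> man_prefers d ?c m y x" for x y
      by (rule man_prefers_total[OF T(1) that(1)]) auto
  qed (use that in auto)
  have g: "g w m < g w m' \<longleftrightarrow> woman_prefers d ?c w m m'" if "m < n" "w < n" "m' < n" for m w m'
    unfolding g_def woman_prefers_conv
  proof (rule card_less_iff_strict_order[OF finite_lessThan])
    show "\<not> man_prefers d ?c' w x x" for x by (rule man_prefers_order)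
    show "man_prefers d ?c' w x y \<Longrightarrow> man_prefers d ?c' w y z \<Longrightarrow> man_prefers d ?c' w x z" for x y z
      by (rule man_prefers_order)
    show "x \<in> {..<n} \<Longrightarrow> y \<in> {..<n} \<Longrightarrow> x \<noteq> y \<Longrightarrow> man_prefers d ?c' w x y \<or> man_prefers d ?c' w y x" for x y
      by (rule man_prefers_total[OF T(2) that(2)]) auto
  qed (use that in auto)
  have f_inj: "inj_on (f m) {..<n}" if "m < n" for m
  proof (rule inj_onI, rule ccontr)
    fix x y assume a: "x \<in> {..<n}" "y \<in> {..<n}" "f m x = f m y" "x \<noteq> y"
    then show False using f[OF that, of x y] f[OF that, of y x] man_prefers_total[OF T(1) that, of x y d am aw Tw] by auto
  qed
  have g_inj: "inj_on (g w) {..<n}" if "w < n" for w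
  proof (rule inj_onI, rule ccontr)
    fix x y assume a: "x \<in> {..<n}" "y \<in> {..<n}" "g w x = g w y" "x \<noteq> y"
    then show False using g[OF _ that, of x y] g[OF _ that, of y x] man_prefers_total[OF T(2) that, of x y d aw am Tm]
      by (auto simp: woman_prefers_conv)
  qed
  interpret market "{..<n}" "{..<n}" f g
    by standard (use f_inj g_inj in auto)
  define L where "L = {(x, hold x) |x. x \<in> {..<n}}"
  have L: "lstable L" using lstable_hold unfolding L_def by simp
  have "is_matching n L"
    unfolding is_matching_def
  proof (intro conjI allI impI)
    show "L \<subseteq> {..<n} \<times> {..<n}" using lstable_in[OF L] by auto
  qed (use lstable_fun[OF L] lstable_inj[OF L] in blast)+
  moreover have "\<not> blocking n d ?c L m w" for m w
  proof
    assume b: "blocking n d ?c L m w"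
    then have mw: "m < n" "w < n" by (auto simp: blocking_def)
    then obtain w' where w': "(m, w') \<in> L" using lstable_ex[OF L, of m] by auto
    have w'n: "w' < n" using lstable_in[OF L w'] by simp
    have "man_prefers d ?c m w w'" using b w' by (simp add: blocking_def)
    then have "f m w < f m w'" using f mw w'n by simp
    then obtain m' where m': "(m', w) \<in> L" "g w m' < g w m" using lstable_block[OF L w', of w] mw by auto
    have "m' < n" using lstable_in[OF L m'(1)] by simp
    moreover have "woman_prefers d ?c w m m'" using b m' by (simp add: blocking_def)
    ultimately have "g w m < g w m'" using g mw by simp
    then show False using m' by simp
  qed
  ultimately show ?thesis unfolding stable_def by blast
qed

text \<open>The preferences are cyclic: \<open>i\<close> favours \<open>r\<close>, \<open>r\<close>
  favours \<open>j\<close>, \<open>j\<close> favours \<open>s\<close> and \<open>s\<close> favours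
  \<open>i\<close>. Thus either perfect matching of the class gives both men, or both women, their
  favourites.\<close>

definition good :: "nat \<Rightarrow> config \<Rightarrow> bool list \<Rightarrow> bool" where
  "good n c p = (case c of (am, aw, Tm, Tw) \<Rightarrow>
     \<exists>i j r s. i \<noteq> j \<and> r \<noteq> s \<and> cls n am p = {i, j} \<and> cls n aw p = {r, s} \<and>
       Tm i r < Tm i s \<and> Tm j s < Tm j r \<and> Tw r j < Tw r i \<and> Tw s i < Tw s j)"

text \<open>All pairs within the class, not a blocking pair. Its symmetric difference with a
  matching replaces one perfect matching of a good class by the other.\<close>

abbreviation block :: "nat \<Rightarrow> config \<Rightarrow> bool list \<Rightarrow> (nat \<times> nat) set" where
  "block n c p \<equiv> cls n (fst c) p \<times> cls n (fst (snd c)) p"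

lemma config_spaceD:
  assumes "(am, aw, Tm, Tw) \<in> config_space n k"
  shows "am \<in> profs n k" "aw \<in> profs n k" "Tm \<in> ties n" "Tw \<in> ties n"
  using assms unfolding config_space_def by auto

lemma good_block:
  assumes c: "c \<in> config_space n k" "c = (am, aw, Tm, Tw)" and met: "metric_on (Qk k) d" and p: "p \<in> Qk k"
    and good: "i \<noteq> j" "r \<noteq> s" "cls n am p = {i, j}" "cls n aw p = {r, s}"
    and st: "stable n d c M"
  shows "M \<inter> {i, j} \<times> {r, s} = {(i, r), (j, s)} \<or> M \<inter> {i, j} \<times> {r, s} = {(i, s), (j, r)}"
proof -
  note cs = config_spaceD[OF c(1)[unfolded c(2)]]
  interpret market "{i, j}" "{r, s}" Tm Tw using market_cls[OF cs(3,4), of am p aw p] good by simp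
  let ?L = "M \<inter> {i, j} \<times> {r, s}"
  have L: "lstable ?L"
    using stable_restrict[OF met cs p _ st[unfolded c(2)]] good by simp
  obtain a where a: "(i, a) \<in> ?L" using lstable_ex[OF L, of i] by blast
  obtain b where b: "(j, b) \<in> ?L" using lstable_ex[OF L, of j] by blast
  have ab: "a \<noteq> b" using lstable_inj[OF L a] b good by blast
  have "a \<in> {r, s}" "b \<in> {r, s}" using a b by auto
  moreover have "?L = {(i, a), (j, b)}"
    using a b lstable_fun[OF L a] lstable_fun[OF L b] by blast
  ultimately show ?thesis using ab by auto
qed

lemma two_pairs_unique:
  assumes "i \<noteq> j" "r \<noteq> s" "A = {(i, s), (j, r)} \<or> A = {(i, r), (j, s)}"
  shows "(m, w) \<in> A \<Longrightarrow> (m, w') \<in> A \<Longrightarrow> w = w'" "(m, w) \<in> A \<Longrightarrow> (m', w) \<in> A \<Longrightarrow> m = m'"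
  using assms by auto

lemma cyclic_ranks_no_blocking:
  fixes f g :: "nat \<Rightarrow> nat \<Rightarrow> nat"
  assumes "A = {(i, s), (j, r)} \<or> A = {(i, r), (j, s)}"
    and "i \<noteq> j" "r \<noteq> s" "f i r < f i s" "f j s < f j r" "g r j < g r i" "g s i < g s j"
    and "(m, w') \<in> A" "(m', w) \<in> A" "f m w < f m w'"
  shows "\<not> g w m < g w m'"
  using assms by auto

text \<open>Partners outside the class do not change, so a new blocking pair would have to meet the
  class. Two members cannot block because of the cyclic ties, and a member never prefers an outsider
  to a partner at distance zero.\<close>

lemma stable_toggle:
  assumes c: "c \<in> config_space n k" and met: "metric_on (Qk k) d" and p: "p \<in> Qk k"
    and good: "good n c p" and st: "stable n d c M"
  shows "stable n d c ((M - block n c p) \<union> (block n c p - M))"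
proof -
  obtain am aw Tm Tw where ce: "c = (am, aw, Tm, Tw)" by (cases c)
  note cs = config_spaceD[OF c[unfolded ce]]
  obtain i j r s where g: "i \<noteq> j" "r \<noteq> s" "cls n am p = {i, j}" "cls n aw p = {r, s}"
    "Tm i r < Tm i s" "Tm j s < Tm j r" "Tw r j < Tw r i" "Tw s i < Tw s j"
    using good unfolding good_def ce by auto
  let ?X = "{i, j}" and ?Y = "{r, s}"
  let ?B = "?X \<times> ?Y"
  define M' where "M' = (M - ?B) \<union> (?B - M)"
  have bl: "block n c p = ?B" using g ce by simp
  have lt: "i < n" "j < n" "r < n" "s < n" using cls_lt[of _ n am p] cls_lt[of _ n aw p] g by auto
  have prof: "am i = p" "am j = p" "aw r = p" "aw s = p" using g(3,4) unfolding cls_def by auto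
  note M = is_matchingD[OF stableD(1)[OF st]] and nb = stableD(2)[OF st]
  have MB: "M \<inter> ?B = {(i, r), (j, s)} \<or> M \<inter> ?B = {(i, s), (j, r)}"
    by (rule good_block[OF c ce met p g(1-4) st])
  have B: "?B = {(i, r), (i, s), (j, r), (j, s)}" by auto
  have M'B: "(M' \<inter> ?B = {(i, s), (j, r)}) \<or> (M' \<inter> ?B = {(i, r), (j, s)})"
  proof -
    have e: "M' \<inter> ?B = ?B - M \<inter> ?B" unfolding M'_def by blast
    from MB show ?thesis
    proof
      assume "M \<inter> ?B = {(i, r), (j, s)}"
      then have "M' \<inter> ?B = {(i, r), (i, s), (j, r), (j, s)} - {(i, r), (j, s)}" using e B by simp
      then show ?thesis using g(1,2) by auto
    next
      assume "M \<inter> ?B = {(i, s), (j, r)}"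
      then have "M' \<inter> ?B = {(i, r), (i, s), (j, r), (j, s)} - {(i, s), (j, r)}" using e B by simp
      then show ?thesis using g(1,2) by auto
    qed
  qed
  have XM: "\<exists>y\<in>?Y. (x, y) \<in> M" if "x \<in> ?X" for x using MB that by blast
  have YM: "\<exists>x\<in>?X. (x, y) \<in> M" if "y \<in> ?Y" for y using MB that by blast
  have in_X: "y \<in> ?Y" if "(x, y) \<in> M" "x \<in> ?X" for x y using XM[OF that(2)] M(2)[OF that(1)] by blast
  have in_Y: "x \<in> ?X" if "(x, y) \<in> M" "y \<in> ?Y" for x y using YM[OF that(2)] M(3)[OF that(1)] by blast
  have out: "(x, y) \<in> M' \<longleftrightarrow> (x, y) \<in> M" if "x \<notin> ?X \<or> y \<notin> ?Y" for x y using that unfolding M'_def by blast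
  have in_X': "y \<in> ?Y" if "(x, y) \<in> M'" "x \<in> ?X" for x y using that in_X[of x y] out[of x y] by blast
  have in_Y': "x \<in> ?X" if "(x, y) \<in> M'" "y \<in> ?Y" for x y using that in_Y[of x y] out[of x y] by blast
  have XM': "\<exists>y\<in>?Y. (x, y) \<in> M'" if "x \<in> ?X" for x using M'B that by blast
  have YM': "\<exists>x\<in>?X. (x, y) \<in> M'" if "y \<in> ?Y" for y using M'B that by blast
  have "is_matching n M'"
    unfolding is_matching_def
  proof (intro conjI allI impI)
    show "M' \<subseteq> {..<n} \<times> {..<n}" using M(1) lt unfolding M'_def by auto
  next
    fix m w w' assume a: "(m, w) \<in> M'" "(m, w') \<in> M'"
    show "w = w'"
    proof (cases "m \<in> ?X")
      case True
      then have "(m, w) \<in> M' \<inter> ?B" "(m, w') \<in> M' \<inter> ?B" using a in_X' by blast+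
      then show ?thesis by (rule two_pairs_unique(1)[OF g(1,2) M'B])
    next
      case False
      then show ?thesis using a out[of m w] out[of m w'] M(2)[of m w w'] by blast
    qed
  next
    fix m m' w assume a: "(m, w) \<in> M'" "(m', w) \<in> M'"
    show "m = m'"
    proof (cases "w \<in> ?Y")
      case True
      then have "(m, w) \<in> M' \<inter> ?B" "(m', w) \<in> M' \<inter> ?B" using a in_Y' by blast+
      then show ?thesis by (rule two_pairs_unique(2)[OF g(1,2) M'B])
    next
      case False
      then show ?thesis using a out[of m w] out[of m' w] M(3)[of m w m'] by blast
    qed
  qed
  moreover have "\<not> blocking n d c M' m w" for m w
  proof
    assume b: "blocking n d c M' m w"
    then have mw: "m < n" "w < n" "(m, w) \<notin> M'"
      and bm: "\<And>w'. (m, w') \<in> M' \<Longrightarrow> man_prefers d c m w w'"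
      and bw: "\<And>m'. (m', w) \<in> M' \<Longrightarrow> woman_prefers d c w m m'"
      by (simp_all add: blocking_def)
    have dm: "d p p < d p (am x)" if "x < n" "x \<notin> ?X" for x
      by (rule metric_self_less[OF met p]) (use that cs(1) g(3) in \<open>auto simp: cls_def\<close>)
    have dw: "d p p < d p (aw x)" if "x < n" "x \<notin> ?Y" for x
      by (rule metric_self_less[OF met p]) (use that cs(2) g(4) in \<open>auto simp: cls_def\<close>)
    show False
    proof (cases "m \<in> ?X")
      case mX: True
      obtain w' where w': "w' \<in> ?Y" "(m, w') \<in> M'" using XM'[OF mX] by blast
      have pm: "man_prefers d c m w w'" using bm w' by blast
      show False
      proof (cases "w \<in> ?Y")
        case True
        then obtain m' where m': "m' \<in> ?X" "(m', w) \<in> M'" using YM' by blast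
        have pw: "woman_prefers d c w m m'" using bw m' by blast
        have 1: "Tm m w < Tm m w'" "Tw w m < Tw w m'"
          using pm pw mX True w' m' prof by (auto simp: ce man_prefers_def woman_prefers_def)
        have "(m, w') \<in> M' \<inter> ?B" "(m', w) \<in> M' \<inter> ?B" using w' m' mX True by blast+
        then show False using cyclic_ranks_no_blocking[OF M'B g(1,2,5-8)] 1 by blast
      next
        case False
        then show False using pm dw[of w] mw mX w' prof by (auto simp: ce man_prefers_def)
      qed
    next
      case mX: False
      show False
      proof (cases "w \<in> ?Y")
        case True
        then obtain m' where m': "m' \<in> ?X" "(m', w) \<in> M'" using YM' by blast
        have pw: "woman_prefers d c w m m'" using bw m' by blast
        then show False using dm[of m] mw mX m' True prof by (auto simp: ce woman_prefers_def)
      next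
        case False
        have "blocking n d c M m w"
          unfolding blocking_def using mw bm bw out mX False by blast
        then show False using nb by blast
      qed
    qed
  qed
  ultimately show ?thesis unfolding stable_def bl M'_def by blast
qed

lemma block_disjoint: "p \<noteq> q \<Longrightarrow> block n c p \<inter> block n c q = {}"
  by (auto simp: cls_def)

lemma good_block_nonempty: "good n c p \<Longrightarrow> block n c p \<noteq> {}"
  by (cases c) (auto simp: good_def)

lemma mem_iff_block_subset:
  assumes "good n c p" shows "p \<in> S \<longleftrightarrow> block n c p \<subseteq> (\<Union>q\<in>S. block n c q)"
proof
  assume sub: "block n c p \<subseteq> (\<Union>q\<in>S. block n c q)"
  obtain x where x: "x \<in> block n c p" using good_block_nonempty[OF assms] by (rule ex_in_conv[THEN iffD2, THEN exE])
  with sub have "x \<in> (\<Union>q\<in>S. block n c q)" by (rule subsetD)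
  then obtain q where q: "q \<in> S" "x \<in> block n c q" by (rule UN_E)
  have "p = q"
  proof (rule ccontr)
    assume "p \<noteq> q"
    then have "block n c p \<inter> block n c q = {}" by (rule block_disjoint)
    then show False using x q(2) by (simp only: disjoint_iff)
  qed
  then show "p \<in> S" using q(1) by simp
qed (rule UN_upper)

lemma stable_toggle_set:
  assumes c: "c \<in> config_space n k" and met: "metric_on (Qk k) d" and S: "finite S" "S \<subseteq> {p \<in> Qk k. good n c p}"
    and st: "stable n d c M"
  shows "stable n d c ((M - (\<Union>p\<in>S. block n c p)) \<union> ((\<Union>p\<in>S. block n c p) - M))"
  using S
proof (induction S rule: finite_induct)
  case empty
  then show ?case using st by simp
next
  case (insert p S)
  let ?U = "\<Union>p\<in>S. block n c p" and ?B = "block n c p"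
  let ?N = "(M - ?U) \<union> (?U - M)"
  have disj: "?U \<inter> ?B = {}" using block_disjoint[of _ p n c] insert(2) by fastforce
  have "stable n d c ((?N - ?B) \<union> (?B - ?N))"
    using insert by (intro stable_toggle[OF c met]) auto
  moreover have "(?N - ?B) \<union> (?B - ?N) = (M - (?U \<union> ?B)) \<union> ((?U \<union> ?B) - M)" using disj by blast
  moreover have "(\<Union>p\<in>insert p S. block n c p) = ?U \<union> ?B" by blast
  ultimately show ?case by simp
qed

lemma stable_matchings_finite: "finite (stable_matchings n d c)"
proof (rule finite_subset)
  show "stable_matchings n d c \<subseteq> Pow ({..<n} \<times> {..<n})"
    by (auto simp: stable_matchings_def stable_def is_matching_def)
qed auto

text \<open>Every set of good classes may be toggled in one fixed stable matching. Comparing the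
  result with that matching gives back the union of the toggled blocks, and their disjointness gives
  back the set.\<close>

lemma card_stable_matchings_ge:
  assumes c: "c \<in> config_space n k" and met: "metric_on (Qk k) d"
  shows "2 ^ card {p \<in> Qk k. good n c p} \<le> card (stable_matchings n d c)"
proof -
  let ?G = "{p \<in> Qk k. good n c p}"
  obtain am aw Tm Tw where ce: "c = (am, aw, Tm, Tw)" by (cases c)
  obtain M where M: "stable n d c M" using stable_exists[OF config_spaceD(3,4)[OF c[unfolded ce]], where d = d and am = am and aw = aw] ce by blast
  have fG: "finite ?G" using Qk by auto
  define \<phi> where "\<phi> = (\<lambda>S. (M - (\<Union>p\<in>S. block n c p)) \<union> ((\<Union>p\<in>S. block n c p) - M))"
  have "inj_on \<phi> (Pow ?G)"
  proof (rule inj_onI)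
    fix S T assume ST: "S \<in> Pow ?G" "T \<in> Pow ?G" and eq: "\<phi> S = \<phi> T"
    have rec: "(\<Union>p\<in>S. block n c p) = (M - \<phi> S) \<union> (\<phi> S - M)" for S unfolding \<phi>_def by blast
    have U: "(\<Union>p\<in>S. block n c p) = (\<Union>p\<in>T. block n c p)" using rec[of S] rec[of T] eq by simp
    have "p \<in> S \<longleftrightarrow> p \<in> T" if "p \<in> ?G" for p
      using that mem_iff_block_subset[of n c p S] mem_iff_block_subset[of n c p T] U by simp
    then show "S = T" using ST by blast
  qed
  moreover have "\<phi> ` Pow ?G \<subseteq> stable_matchings n d c"
    using stable_toggle_set[OF c met _ _ M] finite_subset[OF _ fG] unfolding \<phi>_def stable_matchings_def by blast
  ultimately have "card (Pow ?G) \<le> card (stable_matchings n d c)"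
    by (rule card_inj_on_le[OF _ _ stable_matchings_finite])
  then show ?thesis using fG by (simp add: card_Pow)
qed

lemma stable_partners_manI: "stable n d c M \<Longrightarrow> (m, w) \<in> M \<Longrightarrow> w \<in> stable_partners_man n d c m"
  unfolding stable_partners_man_def by blast

text \<open>One man per good class is enough: toggling gives him both women of the class, and
  classes do not overlap.\<close>

lemma num_multi_ge:
  assumes c: "c \<in> config_space n k" and met: "metric_on (Qk k) d"
  shows "card {p \<in> Qk k. good n c p} \<le> num_multi n d c"
proof -
  let ?G = "{p \<in> Qk k. good n c p}"
  let ?A = "{m \<in> {..<n}. 2 \<le> card (stable_partners_man n d c m)}"
  obtain am aw Tm Tw where ce: "c = (am, aw, Tm, Tw)" by (cases c)
  note cs = config_spaceD[OF c[unfolded ce]]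
  obtain M where M: "stable n d c M" using stable_exists[OF cs(3,4), where d = d and am = am and aw = aw] ce by blast
  have "?G \<subseteq> am ` ?A"
  proof
    fix p assume "p \<in> ?G"
    then have p: "p \<in> Qk k" and gp: "good n c p" by auto
    obtain i j r s where g: "i \<noteq> j" "r \<noteq> s" "cls n am p = {i, j}" "cls n aw p = {r, s}"
      using gp unfolding good_def ce by auto
    have i: "i < n" "am i = p" using g(3) unfolding cls_def by auto
    let ?M' = "(M - block n c p) \<union> (block n c p - M)"
    have st': "stable n d c ?M'" by (rule stable_toggle[OF c met p gp M])
    have bl: "block n c p = {i, j} \<times> {r, s}" using g ce by simp
    from good_block[OF c ce met p g M]
    have "{r, s} \<subseteq> stable_partners_man n d c i"
    proof
      assume "M \<inter> {i, j} \<times> {r, s} = {(i, r), (j, s)}"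
      then have "(i, r) \<in> M" "(i, s) \<in> ?M'" using g(1,2) bl by auto
      then show ?thesis using stable_partners_manI[OF M] stable_partners_manI[OF st'] by simp
    next
      assume "M \<inter> {i, j} \<times> {r, s} = {(i, s), (j, r)}"
      then have "(i, s) \<in> M" "(i, r) \<in> ?M'" using g(1,2) bl by auto
      then show ?thesis using stable_partners_manI[OF M] stable_partners_manI[OF st'] by simp
    qed
    \<comment> \<open>An infinite set would have \<open>card\<close> zero, so finiteness is needed
      before comparing cardinalities.\<close>
    moreover have "finite (stable_partners_man n d c i)"
      by (rule finite_subset[of _ "{..<n}"]) (auto simp: stable_partners_man_def dest!: stableD(1) is_matchingD(1))
    ultimately have "card {r, s} \<le> card (stable_partners_man n d c i)" by (rule card_mono[rotated])
    then have "i \<in> ?A" using i g(2) by simp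
    then show "p \<in> am ` ?A" using i by blast
  qed
  then have "card ?G \<le> card (am ` ?A)" by (intro card_mono) auto
  also have "\<dots> \<le> card ?A" by (rule card_image_le) simp
  finally show ?thesis unfolding num_multi_def by simp
qed

section \<open>Concentration of the number of crossed profiles\<close>

definition num_good :: "nat \<Rightarrow> nat \<Rightarrow> config \<Rightarrow> real" where
  "num_good n k c = real (card {p \<in> Qk k. good n c p})"

lemma good_cong:
  assumes "cls n am p = cls n am' p" "cls n aw p = cls n aw' p"
    "\<And>i. i \<in> cls n am p \<Longrightarrow> Tm i = Tm' i" "\<And>r. r \<in> cls n aw p \<Longrightarrow> Tw r = Tw' r"
  shows "good n (am, aw, Tm, Tw) p \<longleftrightarrow> good n (am', aw', Tm', Tw') p"
proof -
  have "good n (am', aw', Tm', Tw') p"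
    if g: "good n (am, aw, Tm, Tw) p" and c: "cls n am p = cls n am' p" "cls n aw p = cls n aw' p"
      and T: "\<And>i. i \<in> cls n am p \<Longrightarrow> Tm i = Tm' i" "\<And>r. r \<in> cls n aw p \<Longrightarrow> Tw r = Tw' r"
    for am aw Tm Tw am' aw' Tm' Tw'
  proof -
    obtain i j r s where h: "i \<noteq> j" "r \<noteq> s" "cls n am p = {i, j}" "cls n aw p = {r, s}"
      "Tm i r < Tm i s" "Tm j s < Tm j r" "Tw r j < Tw r i" "Tw s i < Tw s j"
      using g unfolding good_def by auto
    moreover have "Tm i = Tm' i" "Tm j = Tm' j" "Tw r = Tw' r" "Tw s = Tw' s" using T h(3,4) by auto
    ultimately have "i \<noteq> j \<and> r \<noteq> s \<and> cls n am' p = {i, j} \<and> cls n aw' p = {r, s} \<and>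
       Tm' i r < Tm' i s \<and> Tm' j s < Tm' j r \<and> Tw' r j < Tw' r i \<and> Tw' s i < Tw' s j" using c by simp
    then show ?thesis unfolding good_def prod.case by blast
  qed
  from this[of am aw Tm Tw am' aw' Tm' Tw'] this[of am' aw' Tm' Tw' am aw Tm Tw] show ?thesis
    using assms by metis
qed

text \<open>A new profile affects only the class that is left and the class that is entered, and a
  new tie-breaking list only the class of its owner, where \<open>u = v\<close>.\<close>

lemma num_good_diff:
  assumes "\<And>p. p \<notin> {u, v} \<Longrightarrow> good n c p \<longleftrightarrow> good n c' p"
  shows "\<bar>num_good n k c - num_good n k c'\<bar> \<le> 2"
proof -
  have le: "card {p \<in> Qk k. good n c p} \<le> card {p \<in> Qk k. good n c' p} + 2"
    if "\<And>p. p \<notin> {u, v} \<Longrightarrow> good n c p \<longleftrightarrow> good n c' p" for c c'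
  proof -
    have "{p \<in> Qk k. good n c p} \<subseteq> {p \<in> Qk k. good n c' p} \<union> {u, v}" using that by blast
    then have "card {p \<in> Qk k. good n c p} \<le> card ({p \<in> Qk k. good n c' p} \<union> {u, v})"
      using Qk(1) by (intro card_mono) auto
    also have "\<dots> \<le> card {p \<in> Qk k. good n c' p} + card {u, v}" by (rule card_Un_le)
    also have "card {u, v} \<le> 2" by (simp add: card_insert_if)
    finally show ?thesis by simp
  qed
  show ?thesis using le[of c c'] le[of c' c] assms unfolding num_good_def by fastforce
qed

lemma cls_upd: "p \<notin> {a i, v} \<Longrightarrow> cls n (a(i := v)) p = cls n a p"
  by (auto simp: cls_def)

text \<open>Four groups of \<open>n\<close> independent coordinates, each coordinate contributing at
  most \<open>2\<^sup>2\<close>.\<close>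

lemma variance_on_num_good: "variance_on (config_space n k) (num_good n k) \<le> 16 * real n"
proof -
  let ?R = "ties n" and ?Q = "profs n k"
  have fin: "finite (?R \<times> ?R)" "?R \<times> ?R \<noteq> {}" "finite (?Q \<times> ?R \<times> ?R)" "?Q \<times> ?R \<times> ?R \<noteq> {}"
    using ties[of n] profs[of n k] by (simp_all del: PiE_eq_empty_iff)
  note S = conjI[OF Qk(1,3)] conjI[OF rankings]
  let ?v = "real (card {..<n}) * 2\<^sup>2"
  have 4: "variance_on ?R (\<lambda>T. num_good n k (am, aw, Tm, T)) \<le> ?v" for am aw Tm
  proof (rule variance_on_lip)
    show "lip {..<n} (\<lambda>_. rankings n) 2 (\<lambda>T. num_good n k (am, aw, Tm, T))"
      unfolding lip_def
    proof (intro ballI)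
      fix T i v
      show "\<bar>num_good n k (am, aw, Tm, T) - num_good n k (am, aw, Tm, T(i := v))\<bar> \<le> 2"
        by (rule num_good_diff[of "aw i" "aw i"], rule good_cong) (auto simp: cls_def)
    qed
  qed (use S in auto)
  have 3: "variance_on (?R \<times> ?R) (\<lambda>b. num_good n k (am, aw, b)) \<le> ?v + ?v" for am aw
  proof (rule variance_on_Times_lip[OF _ _ ties])
    fix Tw
    show "lip {..<n} (\<lambda>_. rankings n) 2 (\<lambda>T. num_good n k (am, aw, T, Tw))"
      unfolding lip_def
    proof (intro ballI)
      fix T i v
      show "\<bar>num_good n k (am, aw, T, Tw) - num_good n k (am, aw, T(i := v), Tw)\<bar> \<le> 2"
        by (rule num_good_diff[of "am i" "am i"], rule good_cong) (auto simp: cls_def)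
    qed
  qed (use S 4 in auto)
  have 2: "variance_on (?Q \<times> ?R \<times> ?R) (\<lambda>b. num_good n k (am, b)) \<le> ?v + (?v + ?v)" for am
  proof (rule variance_on_Times_lip[OF _ _ fin(1,2)])
    fix b :: "(nat \<Rightarrow> nat \<Rightarrow> nat) \<times> (nat \<Rightarrow> nat \<Rightarrow> nat)"
    obtain Tm Tw where b: "b = (Tm, Tw)" by (cases b)
    show "lip {..<n} (\<lambda>_. Qk k) 2 (\<lambda>a. num_good n k (am, a, b))"
      unfolding lip_def b
    proof (intro ballI)
      fix a i v
      show "\<bar>num_good n k (am, a, Tm, Tw) - num_good n k (am, a(i := v), Tm, Tw)\<bar> \<le> 2"
        by (rule num_good_diff[of "a i" v], rule good_cong) (simp_all add: cls_upd)
    qed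
  qed (use S 3 in auto)
  have "variance_on (?Q \<times> ?Q \<times> ?R \<times> ?R) (num_good n k) \<le> ?v + (?v + (?v + ?v))"
  proof (rule variance_on_Times_lip[OF _ _ fin(3,4)])
    fix b :: "(nat \<Rightarrow> bool list) \<times> (nat \<Rightarrow> nat \<Rightarrow> nat) \<times> (nat \<Rightarrow> nat \<Rightarrow> nat)"
    obtain aw Tm Tw where b: "b = (aw, Tm, Tw)" by (cases b)
    show "lip {..<n} (\<lambda>_. Qk k) 2 (\<lambda>a. num_good n k (a, b))"
      unfolding lip_def b
    proof (intro ballI)
      fix a i v
      show "\<bar>num_good n k (a, aw, Tm, Tw) - num_good n k (a(i := v), aw, Tm, Tw)\<bar> \<le> 2"
        by (rule num_good_diff[of "a i" v], rule good_cong) (simp_all add: cls_upd)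
    qed
  qed (use S 2 in auto)
  then show ?thesis by (simp add: config_space_def)
qed

text \<open>Interchanging \<open>r\<close> and \<open>s\<close> in one of the two lists permutes the four possible patterns.\<close>

lemma avg_crossed:
  assumes "i \<noteq> j" "i < n" "j < n" "r \<noteq> s" "r < n" "s < n"
  shows "1 / 4 \<le> avg (ties n) (\<lambda>T. of_bool (T i r < T i s \<and> T j s < T j r))"
proof -
  define \<sigma> where "\<sigma> = (\<lambda>a T. T(a := (T :: nat \<Rightarrow> nat \<Rightarrow> nat) a \<circ> Transposition.transpose r s))"
  let ?G = "{T \<in> ties n. T i r < T i s \<and> T j s < T j r}"
  have fG: "finite ?G" using ties by auto
  have in_ties: "\<sigma> a T \<in> ties n" if "T \<in> ties n" "a < n" for a T
  proof -
    have "T a \<circ> Transposition.transpose r s \<in> rankings n"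
      by (rule ranking_transpose) (use that assms in auto)
    then show ?thesis using that by (auto simp: \<sigma>_def PiE_def Pi_def extensional_def)
  qed
  have inv: "\<sigma> a (\<sigma> a T) = T" for a T
    by (auto simp: \<sigma>_def fun_eq_iff)
  have rs: "\<sigma> a T a r = T a s" "\<sigma> a T a s = T a r" "b \<noteq> a \<Longrightarrow> \<sigma> a T b = T b" for a b T
    by (auto simp: \<sigma>_def)
  have "ties n \<subseteq> ?G \<union> \<sigma> i ` ?G \<union> \<sigma> j ` ?G \<union> \<sigma> i ` \<sigma> j ` ?G"
  proof
    fix T assume T: "T \<in> ties n"
    have ne: "T a r \<noteq> T a s" if "a < n" for a
    proof -
      have "inj_on (T a) {..<n}" using T that ranking_inj by auto
      then show ?thesis using assms by (auto simp: inj_on_def)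
    qed
    consider "T i r < T i s" "T j s < T j r" | "T i s < T i r" "T j s < T j r"
      | "T i r < T i s" "T j r < T j s" | "T i s < T i r" "T j r < T j s"
      using ne assms by (metis linorder_neqE_nat)
    then show "T \<in> ?G \<union> \<sigma> i ` ?G \<union> \<sigma> j ` ?G \<union> \<sigma> i ` \<sigma> j ` ?G"
    proof cases
      case 1
      then show ?thesis using T by blast
    next
      case 2
      then have "\<sigma> i T \<in> ?G" using T in_ties assms rs by simp
      then have "\<sigma> i (\<sigma> i T) \<in> \<sigma> i ` ?G" by (rule imageI)
      then show ?thesis unfolding inv by blast
    next
      case 3
      then have "\<sigma> j T \<in> ?G" using T in_ties assms rs by simp
      then have "\<sigma> j (\<sigma> j T) \<in> \<sigma> j ` ?G" by (rule imageI)
      then show ?thesis unfolding inv by blast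
    next
      case 4
      then have "\<sigma> j (\<sigma> i T) \<in> ?G" using T in_ties assms rs by simp
      then have "\<sigma> i (\<sigma> j (\<sigma> j (\<sigma> i T))) \<in> \<sigma> i ` \<sigma> j ` ?G" by (intro imageI)
      then show ?thesis unfolding inv by blast
    qed
  qed
  then have "card (ties n) \<le> card (?G \<union> \<sigma> i ` ?G \<union> \<sigma> j ` ?G \<union> \<sigma> i ` \<sigma> j ` ?G)"
    using fG by (intro card_mono) auto
  also have "\<dots> \<le> card ?G + card (\<sigma> i ` ?G) + card (\<sigma> j ` ?G) + card (\<sigma> i ` \<sigma> j ` ?G)"
    using card_Un_le order_trans by (smt (verit) add_mono order_refl)
  also have "\<dots> \<le> card ?G + card ?G + card ?G + card ?G"
    using card_image_le[OF fG] card_image_le[OF finite_imageI[OF fG]] by (intro add_mono) (auto intro: order_trans)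
  finally have "real (card (ties n)) \<le> 4 * real (card ?G)" by linarith
  moreover have "real (card (ties n)) > 0" using ties[of n] by (simp only: of_nat_0_less_iff card_gt_0_iff) blast
  ultimately show ?thesis unfolding avg_indicator[OF ties(1)] by (simp add: field_simps)
qed

text \<open>The men's ties and the women's ties are crossed independently, each with probability at
  least \<open>1 / 4\<close>.\<close>

lemma avg_good_ties:
  assumes "card (cls n am p) = 2" "card (cls n aw p) = 2"
  shows "1 / 16 \<le> avg (ties n \<times> ties n) (\<lambda>(Tm, Tw). of_bool (good n (am, aw, Tm, Tw) p))"
proof -
  obtain i j where ij: "cls n am p = {i, j}" "i \<noteq> j" using assms by (auto simp: card_2_iff)
  obtain r s where rs: "cls n aw p = {r, s}" "r \<noteq> s" using assms by (auto simp: card_2_iff)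
  have lt: "i < n" "j < n" "r < n" "s < n" using cls_lt[of _ n am p] cls_lt[of _ n aw p] ij rs by auto
  let ?P = "\<lambda>T. of_bool (T i r < T i s \<and> T j s < T j r) :: real"
  let ?P' = "\<lambda>T. of_bool (T r j < T r i \<and> T s i < T s j) :: real"
  have "(1 / 4) * (1 / 4) \<le> avg (ties n) ?P * avg (ties n) ?P'"
    by (intro mult_mono avg_crossed avg_nonneg) (use lt ij rs in auto)
  also have "\<dots> = avg (ties n \<times> ties n) (\<lambda>(Tm, Tw). ?P Tm * ?P' Tw)"
    unfolding avg_Times prod.case avg_cmult by (simp add: mult.commute[of _ "avg (ties n) ?P'"] avg_cmult)
  also have "\<dots> \<le> avg (ties n \<times> ties n) (\<lambda>(Tm, Tw). of_bool (good n (am, aw, Tm, Tw) p))"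
  proof (rule avg_mono)
    fix x assume "x \<in> ties n \<times> ties n"
    obtain Tm Tw where x: "x = (Tm, Tw)" by (cases x)
    show "(case x of (Tm, Tw) \<Rightarrow> ?P Tm * ?P' Tw) \<le> (case x of (Tm, Tw) \<Rightarrow> of_bool (good n (am, aw, Tm, Tw) p))"
    proof (cases "good n (am, aw, Tm, Tw) p")
      case False
      then have "\<not> ((Tm i r < Tm i s \<and> Tm j s < Tm j r) \<and> (Tw r j < Tw r i \<and> Tw s i < Tw s j))"
        using ij rs unfolding good_def prod.case by blast
      then show ?thesis using x by (simp only: prod.case of_bool_conj[symmetric]) simp
    qed (simp add: x mult_le_one)
  qed
  finally show ?thesis by simp
qed

lemma avg_num_good: "2 ^ k * ((Bernstein n 2 (1 / 2 ^ k))\<^sup>2 / 16) \<le> avg (config_space n k) (num_good n k)"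
proof -
  have q: "1 / real (card (Qk k)) = 1 / 2 ^ k" by (simp add: Qk)
  let ?b = "Bernstein n 2 (1 / 2 ^ k)"
  have prob2: "avg (profs n k) (\<lambda>a. of_bool (card (cls n a p) = 2)) = ?b" if p: "p \<in> Qk k" for p
  proof -
    have "avg (profs n k) (\<lambda>a. of_bool (card (cls n a p) = 2)) = (\<Sum>j\<le>n. Bernstein n j (1 / 2 ^ k) * of_bool (j = 2))"
      unfolding cls_def by (rule avg_count[OF Qk(1) p, unfolded q])
    also have "\<dots> = (if 2 \<le> n then ?b else 0)" by (simp add: of_bool_def if_distrib sum.delta cong: if_cong)
    also have "\<dots> = ?b" by (simp add: Bernstein_gt)
    finally show ?thesis .
  qed
  have "num_good n k = (\<lambda>c. \<Sum>p\<in>Qk k. of_bool (good n c p))"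
    unfolding num_good_def using Qk(1) by (simp add: Int_def)
  then have e: "avg (config_space n k) (num_good n k) = (\<Sum>p\<in>Qk k. avg (config_space n k) (\<lambda>c. of_bool (good n c p)))"
    by (simp only: avg_sum)
  have "2 ^ k * (?b\<^sup>2 / 16) = (\<Sum>p\<in>Qk k. ?b * ?b * (1 / 16))" by (simp add: Qk power2_eq_square)
  also have "\<dots> \<le> (\<Sum>p\<in>Qk k. avg (config_space n k) (\<lambda>c. of_bool (good n c p)))"
  proof (rule sum_mono)
    fix p assume p: "p \<in> Qk k"
    let ?I = "\<lambda>a. of_bool (card (cls n a p) = 2) :: real"
    have "?b * ?b * (1 / 16) = avg (profs n k) (\<lambda>am. (?b * (1 / 16)) * ?I am)"
      unfolding avg_cmult prob2[OF p] by simp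
    also have "\<dots> = avg (profs n k) (\<lambda>am. avg (profs n k) (\<lambda>aw. (1 / 16 * ?I am) * ?I aw))"
    proof (rule avg_cong)
      fix am
      show "(?b * (1 / 16)) * ?I am = avg (profs n k) (\<lambda>aw. (1 / 16 * ?I am) * ?I aw)"
        unfolding avg_cmult prob2[OF p] by (simp only: mult_ac)
    qed
    also have "\<dots> \<le> avg (profs n k) (\<lambda>am. avg (profs n k) (\<lambda>aw. avg (ties n \<times> ties n) (\<lambda>(Tm, Tw). of_bool (good n (am, aw, Tm, Tw) p))))"
    proof (intro avg_mono)
      fix am aw
      show "(1 / 16 * ?I am) * ?I aw \<le> avg (ties n \<times> ties n) (\<lambda>(Tm, Tw). of_bool (good n (am, aw, Tm, Tw) p))"
      proof (cases "card (cls n am p) = 2 \<and> card (cls n aw p) = 2")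
        case True
        then show ?thesis using avg_good_ties[of n am p aw] by simp
      next
        case False
        then have "(1 / 16 * ?I am) * ?I aw = 0" by auto
        then show ?thesis using avg_nonneg[of "ties n \<times> ties n" "\<lambda>(Tm, Tw). of_bool (good n (am, aw, Tm, Tw) p)"] by force
      qed
    qed
    also have "\<dots> = avg (config_space n k) (\<lambda>c. of_bool (good n c p))"
      unfolding config_space_def by (simp only: avg_Times prod.case)
    finally show "?b * ?b * (1 / 16) \<le> avg (config_space n k) (\<lambda>c. of_bool (good n c p))" .
  qed
  finally show ?thesis unfolding e .
qed

section \<open>Numerical estimates for mean class size between one and two, and conclusion\<close>

lemma Bernstein_2_ge:
  assumes k: "1 \<le> k" and n: "2 ^ k \<le> n" "n < 2 * 2 ^ k"
  shows "1 / 64 \<le> Bernstein n 2 (1 / 2 ^ k)"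
proof -
  obtain m where m: "k = Suc m" using k by (cases k) auto
  \<comment> \<open>Half the number of profiles: Bernoulli's inequality then bounds the power with
    exponent \<open>M\<close> below by \<open>1 - M q = 1 / 2\<close>, whereas the full number of
    profiles would only give zero. As \<open>n - 2 \<le> 4 M\<close>, four such factors
    suffice.\<close>
  define M :: nat where "M = 2 ^ m"
  have M: "(2::nat) ^ k = 2 * M" "M \<ge> 1" by (auto simp: M_def m)
  define q :: real where "q = 1 / 2 ^ k"
  have qM: "q = 1 / (2 * real M)" by (simp add: q_def M_def m)
  have q: "0 < q" "q \<le> 1 / 2" using M(2) by (auto simp: qM field_simps)
  have n2: "2 \<le> n" "n \<le> 4 * M" "2 * M \<le> n" using n M by linarith+
  have "1 / 2 = 1 + real M * (- q)" using M(2) by (simp add: qM)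
  also have "\<dots> \<le> (1 + (- q)) ^ M" by (rule Bernoulli_inequality) (use q in auto)
  finally have "(1 / 2) ^ 4 \<le> ((1 - q) ^ M) ^ 4" by (intro power_mono) auto
  also have "\<dots> = (1 - q) ^ (4 * M)" by (simp add: power_mult[symmetric] mult.commute)
  also have "\<dots> \<le> (1 - q) ^ (n - 2)" using q n2 by (intro power_decreasing) auto
  finally have p1: "1 / 16 \<le> (1 - q) ^ (n - 2)" by (simp add: power_divide)
  have "1 \<le> real n * q" using n2 M by (simp add: qM field_simps)
  then have "1\<^sup>2 \<le> (real n * q)\<^sup>2" by (intro power_mono) auto
  then have "1 / 4 \<le> (real n)\<^sup>2 / 4 * q\<^sup>2" by (simp add: power_mult_distrib)
  also have "(real n)\<^sup>2 / 4 * q\<^sup>2 \<le> real (n choose 2) * q\<^sup>2"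
  proof (rule mult_right_mono)
    have "2 * real n \<le> real n * real n" using n2 by (intro mult_right_mono) auto
    then have "(real n)\<^sup>2 / 4 \<le> real n * (real n - 1) / 2"
      by (simp add: power2_eq_square algebra_simps)
    also have "\<dots> = real (n choose 2)"
      using n2 by (simp add: choose_two real_of_nat_div of_nat_diff)
    finally show "(real n)\<^sup>2 / 4 \<le> real (n choose 2)" .
  qed simp
  finally have "1 / 4 \<le> real (n choose 2) * q\<^sup>2" .
  then have "(1 / 4) * (1 / 16) \<le> (real (n choose 2) * q\<^sup>2) * (1 - q) ^ (n - 2)"
    using p1 q by (intro mult_mono) auto
  then show ?thesis by (simp add: Bernstein_def q_def)
qed

text \<open>The mean is at least \<open>2 ^ k / 2 ^ 16\<close>, hence at least \<open>2 t\<close>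
  for \<open>t = n / 2 ^ 18\<close> because \<open>n < 2 * 2 ^ k\<close>. A value below
  \<open>t\<close> therefore deviates by at least \<open>t\<close>, and the variance bound
  \<open>16 n\<close> divided by the square of \<open>t\<close> is
  \<open>2 ^ 40 / n\<close>.\<close>

lemma few_good_unlikely:
  assumes k: "1 \<le> k" and n: "2 ^ k \<le> n" "n < 2 * 2 ^ k"
  shows "card {c \<in> config_space n k. num_good n k c \<le> real n / 2 ^ 18} / card (config_space n k) \<le> 2 ^ 40 / real n"
proof -
  have n0: "n > 0" using n(1) by (cases n) auto
  let ?t = "real n / 2 ^ 18"
  have "(1 / 64)\<^sup>2 \<le> (Bernstein n 2 (1 / 2 ^ k))\<^sup>2" using Bernstein_2_ge[OF assms] by (intro power_mono) auto
  then have "2 ^ k * ((1 / 64)\<^sup>2 / 16) \<le> 2 ^ k * ((Bernstein n 2 (1 / 2 ^ k))\<^sup>2 / 16)"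
    by (intro mult_left_mono divide_right_mono) auto
  also have "\<dots> \<le> avg (config_space n k) (num_good n k)" by (rule avg_num_good)
  finally have "2 ^ k / 2 ^ 16 \<le> avg (config_space n k) (num_good n k)" by (simp add: power2_eq_square)
  moreover have "real n < 2 * 2 ^ k" using n(2) by (metis of_nat_less_iff of_nat_mult of_nat_numeral of_nat_power)
  ultimately have a: "2 * ?t \<le> avg (config_space n k) (num_good n k)" by simp
  have fin: "finite {c \<in> config_space n k. num_good n k c \<le> avg (config_space n k) (num_good n k) - ?t}"
    using config_space(1) by auto
  have "card {c \<in> config_space n k. num_good n k c \<le> ?t} / card (config_space n k)
    \<le> card {c \<in> config_space n k. num_good n k c \<le> avg (config_space n k) (num_good n k) - ?t} / card (config_space n k)"
    using a by (intro divide_right_mono of_nat_mono card_mono[OF fin]) auto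
  also have "\<dots> \<le> variance_on (config_space n k) (num_good n k) / ?t\<^sup>2"
    by (rule chebyshev[OF config_space]) (use n0 in auto)
  also have "\<dots> \<le> (16 * real n) / ?t\<^sup>2" using variance_on_num_good by (intro divide_right_mono) auto
  also have "\<dots> = 2 ^ 40 / real n" using n0 by (simp add: power2_eq_square field_simps)
  finally show ?thesis .
qed

lemma whp_if_many_good:
  fixes k :: "nat \<Rightarrow> nat"
  assumes k_pos: "\<And>n. k n \<ge> 1" and kn: "\<forall>\<^sub>F n in sequentially. int (k n) = \<lfloor>log 2 (real n)\<rfloor>"
    and E: "\<And>n c. c \<in> config_space n (k n) \<Longrightarrow> real n / 2 ^ 18 < num_good n (k n) c \<Longrightarrow> E n c"
  shows "(\<lambda>n. measure_pmf.prob (rpmp n (k n)) {c. E n c}) \<longlonglongrightarrow> 1"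
proof (rule tendsto_sandwich[where h = "\<lambda>_. 1"])
  show "(\<lambda>n. 1 - 2 ^ 40 / real n) \<longlonglongrightarrow> 1"
    using tendsto_diff[OF tendsto_const lim_const_over_n[of "2 ^ 40 :: real"], of 1] by simp
  show "\<forall>\<^sub>F n in sequentially. 1 - 2 ^ 40 / real n \<le> measure_pmf.prob (rpmp n (k n)) {c. E n c}"
    using kn eventually_gt_at_top[of 0]
  proof eventually_elim
    case (elim n)
    let ?S = "config_space n (k n)"
    have n: "2 ^ k n \<le> n" "n < 2 * 2 ^ k n"
    proof -
      have "real (k n) \<le> log 2 (real n)" "log 2 (real n) < real (k n) + 1" using elim by linarith+
      then have "2 powr real (k n) \<le> real n" "real n < 2 powr (real (k n) + 1)"
        using elim by (simp_all add: le_log_iff log_less_iff)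
      then have "real (2 ^ k n) \<le> real n" "real n < real (2 * 2 ^ k n)"
        by (simp_all add: powr_realpow powr_add)
      then show "2 ^ k n \<le> n" "n < 2 * 2 ^ k n" by (simp_all only: of_nat_le_iff of_nat_less_iff)
    qed
    let ?B = "{c \<in> ?S. num_good n (k n) c \<le> real n / 2 ^ 18}"
    have fin: "finite ?S" "card ?S > 0" using config_space by (auto simp: card_gt_0_iff)
    have "?S \<subseteq> {c \<in> ?S. E n c} \<union> ?B" using E by force
    then have "card ?S \<le> card ({c \<in> ?S. E n c} \<union> ?B)" using fin by (intro card_mono) auto
    also have "\<dots> \<le> card {c \<in> ?S. E n c} + card ?B" by (rule card_Un_le)
    finally have "real (card ?S) \<le> real (card {c \<in> ?S. E n c}) + real (card ?B)" by linarith
    then have "1 \<le> (real (card {c \<in> ?S. E n c}) + real (card ?B)) / card ?S"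
      using fin(2) by (subst le_divide_eq_1_pos) auto
    then have "1 \<le> real (card {c \<in> ?S. E n c}) / card ?S + real (card ?B) / card ?S"
      by (simp only: add_divide_distrib)
    moreover have "real (card ?B) / card ?S \<le> 2 ^ 40 / real n" by (rule few_good_unlikely[OF k_pos n])
    ultimately show ?case unfolding prob_rpmp by linarith
  qed
qed auto

text \<open>Since there are only \<open>2 n\<close> participants, the content of the linear order
  claimed in (ii) is this lower bound.\<close>

lemma linearly_many_multi:
  fixes k :: "nat \<Rightarrow> nat" and d :: "nat \<Rightarrow> bool list \<Rightarrow> bool list \<Rightarrow> real"
  assumes "\<And>n. k n \<ge> 1" "\<And>n. metric_on (Qk (k n)) (d n)" "\<forall>\<^sub>F n in sequentially. int (k n) = \<lfloor>log 2 (real n)\<rfloor>"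
  shows "(\<lambda>n. measure_pmf.prob (rpmp n (k n)) {c. real (num_multi n (d n) c) \<ge> 1 / 2 ^ 18 * real n}) \<longlonglongrightarrow> 1"
proof (rule whp_if_many_good[OF assms(1,3)])
  fix n c assume "c \<in> config_space n (k n)" "real n / 2 ^ 18 < num_good n (k n) c"
  then show "real (num_multi n (d n) c) \<ge> 1 / 2 ^ 18 * real n"
    using num_multi_ge[of c n "k n" "d n", OF _ assms(2)] unfolding num_good_def by simp
qed

lemma exponentially_many_stable:
  fixes k :: "nat \<Rightarrow> nat" and d :: "nat \<Rightarrow> bool list \<Rightarrow> bool list \<Rightarrow> real"
  assumes "\<And>n. k n \<ge> 1" "\<And>n. metric_on (Qk (k n)) (d n)" "\<forall>\<^sub>F n in sequentially. int (k n) = \<lfloor>log 2 (real n)\<rfloor>"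
  shows "(\<lambda>n. measure_pmf.prob (rpmp n (k n))
     {c. real (card (stable_matchings n (d n) c)) \<ge> (2 powr (1 / 2 ^ 18)) ^ n}) \<longlonglongrightarrow> 1"
proof (rule whp_if_many_good[OF assms(1,3)])
  fix n c assume c: "c \<in> config_space n (k n)" "real n / 2 ^ 18 < num_good n (k n) c"
  have "(2 powr (1 / 2 ^ 18)) ^ n = 2 powr (real n / 2 ^ 18)"
    by (simp add: powr_realpow[symmetric] powr_powr)
  also have "\<dots> \<le> 2 powr num_good n (k n) c" using c by (intro powr_mono) auto
  also have "\<dots> = real (2 ^ card {p \<in> Qk (k n). good n c p})" by (simp add: num_good_def powr_realpow)
  also have "\<dots> \<le> real (card (stable_matchings n (d n) c))"
    using card_stable_matchings_ge[OF c(1) assms(2)] by (simp only: of_nat_le_iff)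
  finally show "real (card (stable_matchings n (d n) c)) \<ge> (2 powr (1 / 2 ^ 18)) ^ n" .
qed

theorem theorem3p2:
  fixes k :: "nat \<Rightarrow> nat"
    and d :: "nat \<Rightarrow> bool list \<Rightarrow> bool list \<Rightarrow> real"
    and \<epsilon> :: real
  assumes eps: "\<epsilon> > 0"
    and k_pos: "\<And>n. k n \<ge> 1"
    and metric: "\<And>n. metric_on (Qk (k n)) (d n)"
  shows
    "((\<forall>\<^sub>F n in sequentially. real (k n) < (1 - \<epsilon>) * log 2 (real n)) \<longrightarrow>
        (\<forall>\<delta>>0. (\<lambda>n. measure_pmf.prob (rpmp n (k n))
                   {c. real (num_multi n (d n) c) / (2 * real n) > \<delta>}) \<longlonglongrightarrow> 0))
     \<and>
     ((\<forall>\<^sub>F n in sequentially. int (k n) = \<lfloor>log 2 (real n)\<rfloor>) \<longrightarrow>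
        (\<exists>C>0. (\<lambda>n. measure_pmf.prob (rpmp n (k n))
                   {c. real (num_multi n (d n) c) \<ge> C * real n}) \<longlonglongrightarrow> 1) \<and>
        (\<exists>b>1. (\<lambda>n. measure_pmf.prob (rpmp n (k n))
                   {c. real (card (stable_matchings n (d n) c)) \<ge> b ^ n}) \<longlonglongrightarrow> 1))"
proof (intro conjI impI allI)
  fix \<delta> :: real
  assume "\<forall>\<^sub>F n in sequentially. real (k n) < (1 - \<epsilon>) * log 2 (real n)" "\<delta> > 0"
  then show "(\<lambda>n. measure_pmf.prob (rpmp n (k n))
      {c. real (num_multi n (d n) c) / (2 * real n) > \<delta>}) \<longlonglongrightarrow> 0"
    by (rule multi_fraction_tendsto_0[OF eps k_pos metric])
next
  assume kn: "\<forall>\<^sub>F n in sequentially. int (k n) = \<lfloor>log 2 (real n)\<rfloor>"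
  show "\<exists>C>0. (\<lambda>n. measure_pmf.prob (rpmp n (k n))
      {c. real (num_multi n (d n) c) \<ge> C * real n}) \<longlonglongrightarrow> 1"
    by (intro exI[of _ "1 / 2 ^ 18"] conjI linearly_many_multi[OF k_pos metric kn]) simp
  have "1 < 2 powr (1 / 2 ^ 18 :: real)" by simp
  with exponentially_many_stable[OF k_pos metric kn] show "\<exists>b>1. (\<lambda>n. measure_pmf.prob (rpmp n (k n))
      {c. real (card (stable_matchings n (d n) c)) \<ge> b ^ n}) \<longlonglongrightarrow> 1"
    by blast
qed

end
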